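(* The annihilation operator $$A_-:\mathscr{S}'(\mathbb{R})\to\mathscr{S}'(\mathbb{R}),\quad u\mapsto\frac{1}{\sqrt2}(u'+xu)$$ on the space $\mathscr{S}'(\mathbb{R})$ of tempered distributions equipped with the strong dual topology is mixing, sequentially hypercyclic, topologically ergodic, and chaotic.
   Context: $\mathbb{N}=\{1,2,\dots\}$. $\mathscr{S}'(\mathbb{R})$ is the dual of the Schwartz space $\mathscr{S}(\mathbb{R})$, $u'$ is the distributional derivative, and $u\mapsto xu$ denotes multiplication of $u$ by the identity function $x\mapsto x$. For a continuous linear operator $T$ on a topological vector space $E$ and non-empty open $U,W\subseteq E$, let $N_T(U,W)=\{n\in\mathbb{N}:T^n(U)\cap W\ne\emptyset\}$. $T$ is transitive if all $N_T(U,W)$ are non-empty, mixing if they are all cofinite in $\mathbb{N}$, and topologically ergodic if they are all syndetic, where $A\subseteq\mathbb{N}$ is syndetic if there is $q\in\mathbb{N}$ with $\{n,\dots,n+q\}\cap A\neq\emptyset$ for all $n\in\mathbb{N}$. $T$ is sequentially hypercyclic if there is $x\in E$ whose orbit $\{x,Tx,T^2x,\dots\}$ is sequentially dense, i.e. every element of $E$ is the limit of a sequence of elements of the orbit. $T$ is chaotic if it is transitive and the set of its periodic points (points $x$ with $T^Nx=x$ for some $N\in\mathbb{N}$) is dense in $E$. *)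

theory Defs
  imports "HOL-Analysis.Analysis"
begin

section \<open>Dynamics of a map on a topological space\<close>

text \<open>
  The natural numbers of the source start at 1, whence the conditions \<open>1 \<le> n\<close>.
  The notions are stated for arbitrary maps; they are only applied to a continuous linear
  operator.
\<close>

definition hitting_times :: "('a \<Rightarrow> 'a) \<Rightarrow> 'a set \<Rightarrow> 'a set \<Rightarrow> nat set"
  where "hitting_times T U W = {n. 1 \<le> n \<and> (T ^^ n) ` U \<inter> W \<noteq> {}}"

definition syndetic :: "nat set \<Rightarrow> bool"
  where "syndetic A \<longleftrightarrow> (\<exists>q\<ge>1. \<forall>n\<ge>1. {n..n + q} \<inter> A \<noteq> {})"

definition transitive_map :: "('a::topological_space \<Rightarrow> 'a) \<Rightarrow> bool"
  where "transitive_map T \<longleftrightarrow>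
    (\<forall>U W. open U \<and> U \<noteq> {} \<and> open W \<and> W \<noteq> {} \<longrightarrow> hitting_times T U W \<noteq> {})"

definition mixing :: "('a::topological_space \<Rightarrow> 'a) \<Rightarrow> bool"
  where "mixing T \<longleftrightarrow>
    (\<forall>U W. open U \<and> U \<noteq> {} \<and> open W \<and> W \<noteq> {} \<longrightarrow> finite ({1..} - hitting_times T U W))"

definition topologically_ergodic :: "('a::topological_space \<Rightarrow> 'a) \<Rightarrow> bool"
  where "topologically_ergodic T \<longleftrightarrow>
    (\<forall>U W. open U \<and> U \<noteq> {} \<and> open W \<and> W \<noteq> {} \<longrightarrow> syndetic (hitting_times T U W))"

definition sequentially_dense :: "'a::topological_space set \<Rightarrow> bool"
  where "sequentially_dense D \<longleftrightarrow> (\<forall>y. \<exists>s. (\<forall>i::nat. s i \<in> D) \<and> s \<longlonglongrightarrow> y)"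

definition sequentially_hypercyclic :: "('a::topological_space \<Rightarrow> 'a) \<Rightarrow> bool"
  where "sequentially_hypercyclic T \<longleftrightarrow> (\<exists>x. sequentially_dense (range (\<lambda>n. (T ^^ n) x)))"

definition periodic_points :: "('a \<Rightarrow> 'a) \<Rightarrow> 'a set"
  where "periodic_points T = {x. \<exists>N\<ge>1. (T ^^ N) x = x}"

definition chaotic :: "('a::topological_space \<Rightarrow> 'a) \<Rightarrow> bool"
  where "chaotic T \<longleftrightarrow> transitive_map T \<and> closure (periodic_points T) = UNIV"


section \<open>The Schwartz space\<close>

text \<open>Test functions are complex-valued; \<open>(vderiv ^^ n) f\<close> is the \<open>n\<close>-th derivative of \<open>f\<close>.\<close>

definition vderiv :: "(real \<Rightarrow> complex) \<Rightarrow> real \<Rightarrow> complex"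
  where "vderiv f = (\<lambda>x. vector_derivative f (at x))"

definition smooth :: "(real \<Rightarrow> complex) \<Rightarrow> bool"
  where "smooth f \<longleftrightarrow> (\<forall>n x. (vderiv ^^ n) f differentiable at x)"

definition rapidly_decreasing :: "(real \<Rightarrow> complex) \<Rightarrow> bool"
  where "rapidly_decreasing f \<longleftrightarrow>
    (\<forall>k n. bounded (range (\<lambda>x. \<bar>x\<bar> ^ k * cmod ((vderiv ^^ n) f x))))"

lemma rapidly_decreasing_altdef:
  "rapidly_decreasing f \<longleftrightarrow> (\<forall>k n. \<exists>C. \<forall>x. \<bar>x\<bar> ^ k * cmod ((vderiv ^^ n) f x) \<le> C)"
  unfolding rapidly_decreasing_def bounded_iff by (auto simp: abs_mult)

lemma smooth_has_vector_derivative: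
  assumes "smooth f"
  shows "((vderiv ^^ n) f has_vector_derivative (vderiv ^^ Suc n) f x) (at x)"
  using assms by (simp add: smooth_def vderiv_def vector_derivative_works)

lemma vderiv_eqI:
  assumes "\<And>x. (f has_vector_derivative f' x) (at x)"
  shows "vderiv f = f'"
  using assms by (auto simp: vderiv_def fun_eq_iff intro: vector_derivative_at)

lemma vderiv_lincomb:
  assumes "smooth f" "smooth g"
  shows "(vderiv ^^ n) (\<lambda>x. f x + c * g x) = (\<lambda>x. (vderiv ^^ n) f x + c * (vderiv ^^ n) g x)"
proof (induction n)
  case (Suc n)
  have "vderiv (\<lambda>x. (vderiv ^^ n) f x + c * (vderiv ^^ n) g x)
      = (\<lambda>x. (vderiv ^^ Suc n) f x + c * (vderiv ^^ Suc n) g x)"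
    by (rule vderiv_eqI)
      (intro derivative_intros has_vector_derivative_mult_right
         smooth_has_vector_derivative assms)
  with Suc show ?case by simp
qed simp

lemma vderiv_mult_id:
  assumes "smooth f"
  shows "(vderiv ^^ n) (\<lambda>x. of_real x * f x)
    = (\<lambda>x. of_real x * (vderiv ^^ n) f x + of_nat n * (vderiv ^^ (n - 1)) f x)"
proof (induction n)
  case (Suc n)
  have prod: "((\<lambda>x. of_real x * (vderiv ^^ n) f x) has_vector_derivative
      (of_real x * (vderiv ^^ Suc n) f x + 1 * (vderiv ^^ n) f x)) (at x)" for x
  proof (rule has_vector_derivative_mult)
    from has_vector_derivative_of_real[OF DERIV_ident]
    show "((\<lambda>x. complex_of_real x) has_vector_derivative 1) (at x)" by simp
  qed (rule smooth_has_vector_derivative[OF assms])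
  have low: "((\<lambda>x. of_nat n * (vderiv ^^ (n - 1)) f x) has_vector_derivative
      of_nat n * (vderiv ^^ n) f x) (at x)" for x
    by (cases n) (auto intro!: has_vector_derivative_mult_right
        simp del: funpow.simps simp: smooth_has_vector_derivative[OF assms])
  have "vderiv (\<lambda>x. of_real x * (vderiv ^^ n) f x + of_nat n * (vderiv ^^ (n - 1)) f x)
     = (\<lambda>x. of_real x * (vderiv ^^ Suc n) f x + of_nat (Suc n) * (vderiv ^^ n) f x)"
    by (rule vderiv_eqI)
      (rule has_vector_derivative_eq_rhs, rule has_vector_derivative_add, rule prod, rule low,
       simp add: algebra_simps)
  with Suc show ?case by simp
qed simp

lemma smooth_lincomb:
  assumes "smooth f" "smooth g"
  shows "smooth (\<lambda>x. f x + c * g x)"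
  unfolding smooth_def vderiv_lincomb[OF assms]
  using assms unfolding smooth_def
  by (intro allI differentiable_add differentiable_mult differentiable_const) auto

lemma rapidly_decreasing_lincomb:
  assumes "smooth f" "rapidly_decreasing f" "smooth g" "rapidly_decreasing g"
  shows "rapidly_decreasing (\<lambda>x. f x + c * g x)"
  unfolding rapidly_decreasing_altdef vderiv_lincomb[OF assms(1,3)]
proof (intro allI)
  fix k n
  obtain A B where A: "\<And>x. \<bar>x\<bar> ^ k * cmod ((vderiv ^^ n) f x) \<le> A"
    and B: "\<And>x. \<bar>x\<bar> ^ k * cmod ((vderiv ^^ n) g x) \<le> B"
    using assms(2,4) unfolding rapidly_decreasing_altdef by meson
  have "\<bar>x\<bar> ^ k * cmod ((vderiv ^^ n) f x + c * (vderiv ^^ n) g x) \<le> A + cmod c * B" for x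
  proof -
    have "\<bar>x\<bar> ^ k * cmod ((vderiv ^^ n) f x + c * (vderiv ^^ n) g x)
        \<le> \<bar>x\<bar> ^ k * (cmod ((vderiv ^^ n) f x) + cmod c * cmod ((vderiv ^^ n) g x))"
      by (intro mult_left_mono) (auto intro: order.trans[OF norm_triangle_ineq] simp: norm_mult)
    also have "\<dots> = \<bar>x\<bar> ^ k * cmod ((vderiv ^^ n) f x)
        + cmod c * (\<bar>x\<bar> ^ k * cmod ((vderiv ^^ n) g x))"
      by (simp add: algebra_simps)
    also have "\<dots> \<le> A + cmod c * B"
      by (intro add_mono mult_left_mono A B) auto
    finally show ?thesis .
  qed
  then show "\<exists>C. \<forall>x. \<bar>x\<bar> ^ k * cmod ((vderiv ^^ n) f x + c * (vderiv ^^ n) g x) \<le> C"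
    by blast
qed

lemma vderiv_vderiv: "(vderiv ^^ n) (vderiv f) = (vderiv ^^ Suc n) f"
  by (simp only: funpow_Suc_right comp_apply)

lemma smooth_vderiv: "smooth f \<Longrightarrow> smooth (vderiv f)"
  unfolding smooth_def vderiv_vderiv by blast

lemma rapidly_decreasing_vderiv: "rapidly_decreasing f \<Longrightarrow> rapidly_decreasing (vderiv f)"
  unfolding rapidly_decreasing_def vderiv_vderiv by blast

lemma smooth_mult_id:
  assumes "smooth f"
  shows "smooth (\<lambda>x. of_real x * f x)"
proof -
  have "(\<lambda>x::real. complex_of_real x) differentiable at x" for x
    by (simp add: bounded_linear_imp_differentiable bounded_linear_of_real)
  then show ?thesis
    using assms unfolding smooth_def vderiv_mult_id[OF assms]
    by (intro allI differentiable_add differentiable_mult differentiable_const) auto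
qed

lemma seminorm_mult_id_bound:
  assumes "\<bar>x\<bar> ^ Suc k * cmod a \<le> A" "\<bar>x\<bar> ^ k * cmod b \<le> B"
  shows "\<bar>x\<bar> ^ k * cmod (of_real x * a + of_nat n * b) \<le> A + real n * B"
proof -
  have "\<bar>x\<bar> ^ k * cmod (of_real x * a + of_nat n * b)
      \<le> \<bar>x\<bar> ^ k * (\<bar>x\<bar> * cmod a + real n * cmod b)"
    by (intro mult_left_mono) (auto intro: order.trans[OF norm_triangle_ineq] simp: norm_mult)
  also have "\<dots> = \<bar>x\<bar> ^ Suc k * cmod a + real n * (\<bar>x\<bar> ^ k * cmod b)"
    by (simp add: algebra_simps)
  also have "\<dots> \<le> A + real n * B"
    by (intro add_mono mult_left_mono assms) auto
  finally show ?thesis .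
qed

lemma rapidly_decreasing_mult_id:
  assumes "smooth f" "rapidly_decreasing f"
  shows "rapidly_decreasing (\<lambda>x. of_real x * f x)"
  unfolding rapidly_decreasing_altdef vderiv_mult_id[OF assms(1)]
proof (intro allI)
  fix k n
  obtain A B where "\<And>x. \<bar>x\<bar> ^ Suc k * cmod ((vderiv ^^ n) f x) \<le> A"
    and "\<And>x. \<bar>x\<bar> ^ k * cmod ((vderiv ^^ (n - 1)) f x) \<le> B"
    using assms(2) unfolding rapidly_decreasing_altdef by meson
  then show "\<exists>C. \<forall>x. \<bar>x\<bar> ^ k *
      cmod (of_real x * (vderiv ^^ n) f x + of_nat n * (vderiv ^^ (n - 1)) f x) \<le> C"
    by (blast intro: seminorm_mult_id_bound)
qed

lemma vderiv_zero [simp]: "(vderiv ^^ n) (\<lambda>_. 0) = (\<lambda>_. 0)"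
  by (induction n) (simp_all add: vderiv_eqI[OF has_vector_derivative_const])

lemma smooth_zero: "smooth (\<lambda>_. 0)"
  unfolding smooth_def vderiv_zero by simp

lemma rapidly_decreasing_zero: "rapidly_decreasing (\<lambda>_. 0)"
  unfolding rapidly_decreasing_altdef vderiv_zero by auto

typedef schwartz = "{f. smooth f \<and> rapidly_decreasing f}"
  morphisms schwartz_apply Abs_schwartz
  using smooth_zero rapidly_decreasing_zero by blast

setup_lifting type_definition_schwartz

instantiation schwartz :: real_vector
begin

lift_definition zero_schwartz :: schwartz is "\<lambda>_. 0"
  using smooth_zero rapidly_decreasing_zero by blast

lift_definition plus_schwartz :: "schwartz \<Rightarrow> schwartz \<Rightarrow> schwartz" is "\<lambda>f g x. f x + g x"
  using smooth_lincomb[where c = 1] rapidly_decreasing_lincomb[where c = 1] by auto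

lift_definition minus_schwartz :: "schwartz \<Rightarrow> schwartz \<Rightarrow> schwartz" is "\<lambda>f g x. f x - g x"
  using smooth_lincomb[where c = "-1"] rapidly_decreasing_lincomb[where c = "-1"] by auto

lift_definition uminus_schwartz :: "schwartz \<Rightarrow> schwartz" is "\<lambda>f x. - f x"
  using smooth_lincomb[OF smooth_zero, where c = "-1"]
    rapidly_decreasing_lincomb[OF smooth_zero rapidly_decreasing_zero, where c = "-1"] by auto

lift_definition scaleR_schwartz :: "real \<Rightarrow> schwartz \<Rightarrow> schwartz" is "\<lambda>r f x. r *\<^sub>R f x"
  unfolding scaleR_conv_of_real
  using smooth_lincomb[OF smooth_zero]
    rapidly_decreasing_lincomb[OF smooth_zero rapidly_decreasing_zero] by auto

instance
  by standard (transfer; simp add: algebra_simps)+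

end

lift_definition schwartz_scale :: "complex \<Rightarrow> schwartz \<Rightarrow> schwartz" is "\<lambda>c f x. c * f x"
  using smooth_lincomb[OF smooth_zero]
    rapidly_decreasing_lincomb[OF smooth_zero rapidly_decreasing_zero] by auto

lift_definition schwartz_deriv :: "schwartz \<Rightarrow> schwartz" is vderiv
  using smooth_vderiv rapidly_decreasing_vderiv by blast

lift_definition schwartz_mult_id :: "schwartz \<Rightarrow> schwartz" is "\<lambda>f x. of_real x * f x"
  using smooth_mult_id rapidly_decreasing_mult_id by blast

definition schwartz_seminorm :: "nat \<Rightarrow> nat \<Rightarrow> schwartz \<Rightarrow> real"
  where "schwartz_seminorm k n f = (SUP x. \<bar>x\<bar> ^ k * cmod ((vderiv ^^ n) (schwartz_apply f) x))"

text \<open>The locally convex topology defined by the seminorms.\<close>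

instantiation schwartz :: topological_space
begin

definition open_schwartz :: "schwartz set \<Rightarrow> bool"
  where "open U \<longleftrightarrow> (\<forall>f\<in>U. \<exists>N. \<exists>e>0. \<forall>g.
    (\<forall>k\<le>N. \<forall>n\<le>N. schwartz_seminorm k n (g - f) < e) \<longrightarrow> g \<in> U)"

instance
proof
  show "open (UNIV :: schwartz set)"
    by (auto simp: open_schwartz_def intro: exI[of _ 1])
next
  fix S T :: "schwartz set"
  assume S: "open S" and T: "open T"
  show "open (S \<inter> T)"
    unfolding open_schwartz_def
  proof
    fix f assume f: "f \<in> S \<inter> T"
    obtain M d where M: "d > 0"
      "\<And>g. (\<forall>k\<le>M. \<forall>n\<le>M. schwartz_seminorm k n (g - f) < d) \<Longrightarrow> g \<in> S"
      using S f unfolding open_schwartz_def by (meson IntD1)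
    obtain N e where N: "e > 0"
      "\<And>g. (\<forall>k\<le>N. \<forall>n\<le>N. schwartz_seminorm k n (g - f) < e) \<Longrightarrow> g \<in> T"
      using T f unfolding open_schwartz_def by (meson IntD2)
    have "g \<in> S \<inter> T"
      if "\<forall>k\<le>max M N. \<forall>n\<le>max M N. schwartz_seminorm k n (g - f) < min d e" for g
      using that by (auto intro!: M(2) N(2))
    then show "\<exists>N. \<exists>e>0. \<forall>g.
        (\<forall>k\<le>N. \<forall>n\<le>N. schwartz_seminorm k n (g - f) < e) \<longrightarrow> g \<in> S \<inter> T"
      using M(1) N(1) by (intro exI[of _ "max M N"] exI[of _ "min d e"]) auto
  qed
next
  fix K :: "schwartz set set"
  assume "\<forall>S\<in>K. open S"
  then show "open (\<Union>K)"
    unfolding open_schwartz_def by (meson UnionE UnionI)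
qed

end

text \<open>
  A subset of a locally convex space is bounded iff every seminorm of a defining family is
  bounded on it.
\<close>

definition schwartz_bounded :: "schwartz set \<Rightarrow> bool"
  where "schwartz_bounded B \<longleftrightarrow> (\<forall>k n. \<exists>C. \<forall>f\<in>B. schwartz_seminorm k n f \<le> C)"

lemma schwartz_bounded_empty: "schwartz_bounded {}"
  by (simp add: schwartz_bounded_def)

lemma schwartz_bounded_Un:
  assumes "schwartz_bounded A" "schwartz_bounded B"
  shows "schwartz_bounded (A \<union> B)"
  unfolding schwartz_bounded_def
proof (intro allI)
  fix k n
  obtain C D where "\<And>f. f \<in> A \<Longrightarrow> schwartz_seminorm k n f \<le> C"
    and "\<And>f. f \<in> B \<Longrightarrow> schwartz_seminorm k n f \<le> D"
    using assms unfolding schwartz_bounded_def by meson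
  then show "\<exists>C. \<forall>f\<in>A \<union> B. schwartz_seminorm k n f \<le> C"
    by (intro exI[of _ "max C D"]) (auto simp: le_max_iff_disj)
qed

lemma schwartz_seminorm_upper:
  "\<bar>x\<bar> ^ k * cmod ((vderiv ^^ n) (schwartz_apply f) x) \<le> schwartz_seminorm k n f"
proof -
  have "bounded (range (\<lambda>x. \<bar>x\<bar> ^ k * cmod ((vderiv ^^ n) (schwartz_apply f) x)))"
    using schwartz_apply[of f] by (auto simp: rapidly_decreasing_def)
  then show ?thesis
    unfolding schwartz_seminorm_def
    by (intro cSUP_upper) (auto intro: bounded_imp_bdd_above)
qed

lemma schwartz_seminorm_deriv:
  "schwartz_seminorm k n (schwartz_deriv f) = schwartz_seminorm k (Suc n) f"
  unfolding schwartz_seminorm_def schwartz_deriv.rep_eq vderiv_vderiv ..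

lemma schwartz_seminorm_mult_id:
  "schwartz_seminorm k n (schwartz_mult_id f)
    \<le> schwartz_seminorm (Suc k) n f + real n * schwartz_seminorm k (n - 1) f"
proof -
  have "smooth (schwartz_apply f)"
    using schwartz_apply[of f] by auto
  then show ?thesis
    unfolding schwartz_seminorm_def[of k n "schwartz_mult_id f"]
      schwartz_mult_id.rep_eq vderiv_mult_id[OF \<open>smooth (schwartz_apply f)\<close>]
    by (intro cSUP_least seminorm_mult_id_bound schwartz_seminorm_upper) auto
qed

lemma continuous_on_schwartzI:
  fixes L :: "schwartz \<Rightarrow> schwartz"
  assumes diff: "\<And>f g. L (f - g) = L f - L g"
    and bound: "\<And>N e. e > 0 \<Longrightarrow> \<exists>M. \<exists>d>0. \<forall>f.
      (\<forall>k\<le>M. \<forall>n\<le>M. schwartz_seminorm k n f < d) \<longrightarrow>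
      (\<forall>k\<le>N. \<forall>n\<le>N. schwartz_seminorm k n (L f) < e)"
  shows "continuous_on UNIV L"
proof -
  have "open (L -` U)" if U: "open U" for U
    unfolding open_schwartz_def
  proof
    fix f assume "f \<in> L -` U"
    then obtain N e where e: "e > 0"
      "\<And>g. (\<forall>k\<le>N. \<forall>n\<le>N. schwartz_seminorm k n (g - L f) < e) \<Longrightarrow> g \<in> U"
      using U unfolding open_schwartz_def by (meson vimageE)
    obtain M d where d: "d > 0" "\<And>f. (\<forall>k\<le>M. \<forall>n\<le>M. schwartz_seminorm k n f < d) \<Longrightarrow>
        (\<forall>k\<le>N. \<forall>n\<le>N. schwartz_seminorm k n (L f) < e)"
      using bound[OF e(1), of N] by meson
    have "g \<in> L -` U" if "\<forall>k\<le>M. \<forall>n\<le>M. schwartz_seminorm k n (g - f) < d" for g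
      using d(2)[OF that] e(2)[of "L g"] by (simp add: diff)
    with d(1) show "\<exists>N. \<exists>e>0. \<forall>g.
        (\<forall>k\<le>N. \<forall>n\<le>N. schwartz_seminorm k n (g - f) < e) \<longrightarrow> g \<in> L -` U"
      by blast
  qed
  then show ?thesis
    by (simp add: continuous_on_open_vimage)
qed

lemma schwartz_deriv_lincomb:
  "schwartz_deriv (f + schwartz_scale c g) = schwartz_deriv f + schwartz_scale c (schwartz_deriv g)"
  by transfer (use vderiv_lincomb[where n = 1] in simp)

lemma schwartz_scale_simps [simp]: "schwartz_scale 1 f = f" "schwartz_scale (-1) f = - f"
  "schwartz_scale c 0 = 0"
  by (transfer; simp)+

lemma schwartz_deriv_add: "schwartz_deriv (f + g) = schwartz_deriv f + schwartz_deriv g"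
  using schwartz_deriv_lincomb[of f 1 g] by simp

lemma schwartz_deriv_scale: "schwartz_deriv (schwartz_scale c f) = schwartz_scale c (schwartz_deriv f)"
  using schwartz_deriv_lincomb[of 0 c f] schwartz_deriv_lincomb[of 0 1 0] by simp

lemma schwartz_mult_id_add: "schwartz_mult_id (f + g) = schwartz_mult_id f + schwartz_mult_id g"
  by transfer (simp add: algebra_simps)

lemma schwartz_mult_id_scale:
  "schwartz_mult_id (schwartz_scale c f) = schwartz_scale c (schwartz_mult_id f)"
  by transfer (simp add: algebra_simps)

lemma continuous_schwartz_deriv: "continuous_on UNIV schwartz_deriv"
proof (rule continuous_on_schwartzI)
  show "schwartz_deriv (f - g) = schwartz_deriv f - schwartz_deriv g" for f g
    using schwartz_deriv_lincomb[of f "-1" g] by simp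
  show "\<exists>M. \<exists>d>0. \<forall>f. (\<forall>k\<le>M. \<forall>n\<le>M. schwartz_seminorm k n f < d) \<longrightarrow>
      (\<forall>k\<le>N. \<forall>n\<le>N. schwartz_seminorm k n (schwartz_deriv f) < e)" if "e > 0" for N e
    unfolding schwartz_seminorm_deriv
    by (rule exI[of _ "Suc N"], rule exI[of _ e]) (simp add: that)
qed

lemma continuous_schwartz_mult_id: "continuous_on UNIV schwartz_mult_id"
proof (rule continuous_on_schwartzI)
  show "schwartz_mult_id (f - g) = schwartz_mult_id f - schwartz_mult_id g" for f g
    by transfer (simp add: algebra_simps)
next
  fix N :: nat and e :: real
  assume e: "e > 0"
  let ?d = "e / (N + 2)"
  have "schwartz_seminorm k n (schwartz_mult_id f) < e"
    if f: "\<forall>k\<le>Suc N. \<forall>n\<le>Suc N. schwartz_seminorm k n f < ?d" and kn: "k \<le> N" "n \<le> N" for f k n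
  proof -
    have "schwartz_seminorm k n (schwartz_mult_id f)
        \<le> schwartz_seminorm (Suc k) n f + real n * schwartz_seminorm k (n - 1) f"
      by (rule schwartz_seminorm_mult_id)
    also have "\<dots> \<le> ?d + real N * ?d"
    proof (intro add_mono mult_mono)
      show "schwartz_seminorm (Suc k) n f \<le> ?d" "schwartz_seminorm k (n - 1) f \<le> ?d"
        using f kn by (auto intro!: less_imp_le)
      show "0 \<le> schwartz_seminorm k (n - 1) f"
        by (rule order.trans[OF _ schwartz_seminorm_upper[of 0]]) auto
    qed (use kn in auto)
    also have "\<dots> = e * ((N + 1) / (N + 2))"
      by (simp add: algebra_simps flip: add_divide_distrib)
    also have "\<dots> < e * 1"
      using e by (intro mult_strict_left_mono) auto
    also have "\<dots> = e"
      by simp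
    finally show ?thesis .
  qed
  moreover have "?d > 0"
    using e by simp
  ultimately show "\<exists>M. \<exists>d>0. \<forall>f. (\<forall>k\<le>M. \<forall>n\<le>M. schwartz_seminorm k n f < d) \<longrightarrow>
      (\<forall>k\<le>N. \<forall>n\<le>N. schwartz_seminorm k n (schwartz_mult_id f) < e)"
    by blast
qed

lemma schwartz_bounded_deriv:
  assumes "schwartz_bounded B"
  shows "schwartz_bounded (schwartz_deriv ` B)"
  using assms by (auto simp: schwartz_bounded_def schwartz_seminorm_deriv)

lemma schwartz_bounded_mult_id:
  assumes "schwartz_bounded B"
  shows "schwartz_bounded (schwartz_mult_id ` B)"
  unfolding schwartz_bounded_def
proof (intro allI)
  fix k n
  obtain C D where "\<And>f. f \<in> B \<Longrightarrow> schwartz_seminorm (Suc k) n f \<le> C"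
    and "\<And>f. f \<in> B \<Longrightarrow> schwartz_seminorm k (n - 1) f \<le> D"
    using assms unfolding schwartz_bounded_def by meson
  then have "schwartz_seminorm k n (schwartz_mult_id f) \<le> C + real n * D" if "f \<in> B" for f
    using that
    by (intro order.trans[OF schwartz_seminorm_mult_id] add_mono mult_left_mono) auto
  then show "\<exists>C. \<forall>f\<in>schwartz_mult_id ` B. schwartz_seminorm k n f \<le> C"
    by blast
qed


section \<open>Tempered distributions\<close>

typedef tempered = "{u :: schwartz \<Rightarrow> complex.
    (\<forall>f g. u (f + g) = u f + u g) \<and> (\<forall>c f. u (schwartz_scale c f) = c * u f) \<and>
    continuous_on UNIV u}"
  morphisms tempered_apply Abs_tempered
  by (rule exI[of _ "\<lambda>_. 0"]) auto

setup_lifting type_definition_tempered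

instantiation tempered :: real_vector
begin

lift_definition zero_tempered :: tempered is "\<lambda>_. 0"
  by auto

lift_definition plus_tempered :: "tempered \<Rightarrow> tempered \<Rightarrow> tempered" is "\<lambda>u v f. u f + v f"
  by (auto simp: algebra_simps intro!: continuous_intros)

lift_definition minus_tempered :: "tempered \<Rightarrow> tempered \<Rightarrow> tempered" is "\<lambda>u v f. u f - v f"
  by (auto simp: algebra_simps intro!: continuous_intros)

lift_definition uminus_tempered :: "tempered \<Rightarrow> tempered" is "\<lambda>u f. - u f"
  by (auto simp: algebra_simps intro!: continuous_intros)

lift_definition scaleR_tempered :: "real \<Rightarrow> tempered \<Rightarrow> tempered" is "\<lambda>r u f. r *\<^sub>R u f"
  by (auto simp: algebra_simps intro!: continuous_intros)

instance
  by standard (transfer; simp add: algebra_simps)+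

end

text \<open>
  The strong dual topology, i.e. that of uniform convergence on bounded sets.  Single bounded sets
  suffice for the basic neighbourhoods because finite unions of bounded sets are bounded.
\<close>

instantiation tempered :: topological_space
begin

definition open_tempered :: "tempered set \<Rightarrow> bool"
  where "open U \<longleftrightarrow> (\<forall>u\<in>U. \<exists>B e. schwartz_bounded B \<and> e > 0 \<and>
    (\<forall>v. (\<forall>f\<in>B. cmod (tempered_apply v f - tempered_apply u f) < e) \<longrightarrow> v \<in> U))"

instance
proof
  show "open (UNIV :: tempered set)"
    by (auto simp: open_tempered_def intro: exI[of _ 1] schwartz_bounded_empty)
next
  fix S T :: "tempered set"
  assume S: "open S" and T: "open T"
  show "open (S \<inter> T)"
    unfolding open_tempered_def
  proof
    fix u assume u: "u \<in> S \<inter> T"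
    obtain A d where A: "schwartz_bounded A" "d > 0"
      "\<And>v. (\<forall>f\<in>A. cmod (tempered_apply v f - tempered_apply u f) < d) \<Longrightarrow> v \<in> S"
      using S u unfolding open_tempered_def by (meson IntD1)
    obtain B e where B: "schwartz_bounded B" "e > 0"
      "\<And>v. (\<forall>f\<in>B. cmod (tempered_apply v f - tempered_apply u f) < e) \<Longrightarrow> v \<in> T"
      using T u unfolding open_tempered_def by (meson IntD2)
    have "v \<in> S \<inter> T"
      if "\<forall>f\<in>A \<union> B. cmod (tempered_apply v f - tempered_apply u f) < min d e" for v
      using that by (auto intro!: A(3) B(3))
    then show "\<exists>B e. schwartz_bounded B \<and> e > 0 \<and>
        (\<forall>v. (\<forall>f\<in>B. cmod (tempered_apply v f - tempered_apply u f) < e) \<longrightarrow> v \<in> S \<inter> T)"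
      using A(1,2) B(1,2)
      by (intro exI[of _ "A \<union> B"] exI[of _ "min d e"]) (auto intro: schwartz_bounded_Un)
  qed
next
  fix K :: "tempered set set"
  assume "\<forall>S\<in>K. open S"
  then show "open (\<Union>K)"
    unfolding open_tempered_def by (meson UnionE UnionI)
qed

end

lift_definition tempered_deriv :: "tempered \<Rightarrow> tempered" is "\<lambda>u f. - u (schwartz_deriv f)"
  by (auto simp: schwartz_deriv_add schwartz_deriv_scale
      intro!: continuous_intros continuous_on_compose2[OF _ continuous_schwartz_deriv])

lift_definition tempered_mult_id :: "tempered \<Rightarrow> tempered" is "\<lambda>u f. u (schwartz_mult_id f)"
  by (auto simp: schwartz_mult_id_add schwartz_mult_id_scale
      intro!: continuous_on_compose2[OF _ continuous_schwartz_mult_id])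

definition annihilation :: "tempered \<Rightarrow> tempered"
  where "annihilation u = (1 / sqrt 2) *\<^sub>R (tempered_deriv u + tempered_mult_id u)"

lift_definition tempered_scale :: "complex \<Rightarrow> tempered \<Rightarrow> tempered" is "\<lambda>c u f. c * u f"
  by (auto simp: algebra_simps intro!: continuous_intros)

lemma annihilation_add: "annihilation (u + v) = annihilation u + annihilation v"
  unfolding annihilation_def by transfer (simp add: algebra_simps)

lemma annihilation_scale: "annihilation (tempered_scale c u) = tempered_scale c (annihilation u)"
  unfolding annihilation_def by transfer (simp add: algebra_simps)

lemma tempered_apply_annihilation:
  "tempered_apply (annihilation u) f =
    (1 / sqrt 2) *\<^sub>R (tempered_apply u (schwartz_mult_id f) - tempered_apply u (schwartz_deriv f))"
  unfolding annihilation_def by transfer simp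

lemma continuous_annihilation: "continuous_on UNIV annihilation"
proof -
  have "open (annihilation -` U)" if U: "open U" for U
    unfolding open_tempered_def
  proof
    fix u assume "u \<in> annihilation -` U"
    then obtain B e where B: "schwartz_bounded B" "e > 0"
      "\<And>v. (\<forall>f\<in>B. cmod (tempered_apply v f - tempered_apply (annihilation u) f) < e) \<Longrightarrow> v \<in> U"
      using U unfolding open_tempered_def by (meson vimageE)
    let ?B = "schwartz_mult_id ` B \<union> schwartz_deriv ` B"
    have "v \<in> annihilation -` U"
      if v: "\<forall>f\<in>?B. cmod (tempered_apply v f - tempered_apply u f) < e / 2" for v
    proof -
      have "cmod (tempered_apply (annihilation v) f - tempered_apply (annihilation u) f) < e"
        if "f \<in> B" for f
      proof -
        define a where "a = tempered_apply v (schwartz_mult_id f) - tempered_apply u (schwartz_mult_id f)"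
        define b where "b = tempered_apply v (schwartz_deriv f) - tempered_apply u (schwartz_deriv f)"
        have ab: "cmod a < e / 2" "cmod b < e / 2"
          using v that by (auto simp: a_def b_def)
        have "tempered_apply (annihilation v) f - tempered_apply (annihilation u) f
            = (1 / sqrt 2) *\<^sub>R (a - b)"
          by (simp add: tempered_apply_annihilation a_def b_def algebra_simps flip: scaleR_diff_right)
        then have "cmod (tempered_apply (annihilation v) f - tempered_apply (annihilation u) f)
            = cmod (a - b) / sqrt 2"
          by simp
        also have "\<dots> \<le> cmod (a - b)"
          by (simp add: divide_le_eq mult_le_cancel_left1)
        also have "\<dots> < e"
          using ab norm_triangle_ineq4[of a b] by linarith
        finally show ?thesis .
      qed
      then show ?thesis
        using B(3) by simp
    qed
    moreover have "schwartz_bounded ?B"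
      by (intro schwartz_bounded_Un schwartz_bounded_mult_id schwartz_bounded_deriv B(1))
    ultimately show "\<exists>B e. schwartz_bounded B \<and> e > 0 \<and>
        (\<forall>v. (\<forall>f\<in>B. cmod (tempered_apply v f - tempered_apply u f) < e) \<longrightarrow> v \<in> annihilation -` U)"
      using B(2) by (intro exI[of _ ?B] exI[of _ "e / 2"]) auto
  qed
  then show ?thesis
    by (simp add: continuous_on_open_vimage)
qed

end

theory Submission
  imports Defs "HOL-Probability.Sinc_Integral" "HOL-Library.Discrete_Functions"
begin

text \<open>
  The annihilation operator lowers the Hermite functions, \<open>A h\<^sub>n = \<surd>n h\<^bsub>n-1\<^esub>\<close>.  If a tempered
  distribution \<open>u\<close> is encoded by the sequence of its Hermite coefficients \<open>u(h\<^sub>n)\<close>, then \<open>A\<close> becomes the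
  weighted backward shift \<open>(a\<^sub>n) \<mapsto> (\<surd>(n+1) a\<^bsub>n+1\<^esub>)\<close>.  The first part of the development shows that
  the encoding is a bijection onto the sequences of polynomial growth, and that uniform convergence of
  coefficients with respect to some polynomial weight implies strong convergence of distributions
  (\<open>tempered_apply_sums\<close>, \<open>tempered_coeff_bound\<close>, \<open>tempered_of_coeffs\<close>, \<open>tempered_tendstoI\<close>).  All of
  this rests on the convergence of the Hermite expansion of a Schwartz function \<open>f\<close> in the Schwartz
  space.  The coefficients decay rapidly, because \<open>h\<^sub>n\<close> is an eigenfunction of the symmetric operator
  \<open>x\<^sup>2 - d\<^sup>2/dx\<^sup>2\<close>, and the seminorms of \<open>h\<^sub>n\<close> grow polynomially, by a Sobolev inequality; so only
  the value of the sum is in question.  It is \<open>f\<close> since the expansion commutes with multiplication by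
  \<open>x\<close> and reproduces \<open>h\<^sub>0\<close>: to evaluate it at a point \<open>x\<close>, write \<open>f = c h\<^sub>0 + (id - x) g\<close> with a
  Schwartz function \<open>g\<close> (\<open>schwartz_division\<close>, \<open>hermite_series_mult_id\<close>, \<open>hermite_series_sums\<close>).

  The dynamics take place on sequences.  The weights being at least \<open>1\<close>, the right inverse of the shift,
  \<open>b \<mapsto> (\<surd>((k-n)!/k!) b\<^bsub>k-n\<^esub>)\<^bsub>k\<ge>n\<^esub>\<close> for the \<open>n\<close>-th power, preserves polynomial bounds, and a change of
  a sequence beyond the index \<open>n\<close> is of order \<open>1/n\<close> in the next polynomial weight (\<open>tail_bound\<close>).
  Hence one may keep the first \<open>n\<close> coefficients of \<open>u\<close> and choose all others such that the \<open>n\<close>-th power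
  of the operator yields a given \<open>w\<close> (mixing), such that the vector is periodic (chaos), or such that ever
  later blocks of it run through a dense set of finite sequences (sequential hypercyclicity).
  Topological ergodicity and transitivity follow from mixing.
\<close>

section \<open>Schwartz functions\<close>

lemma schwartz_eqI: "(\<And>x. schwartz_apply f x = schwartz_apply g x) \<Longrightarrow> f = g"
  by (metis ext schwartz_apply_inject)

lemmas schwartz_apply_simps =
  plus_schwartz.rep_eq minus_schwartz.rep_eq uminus_schwartz.rep_eq zero_schwartz.rep_eq
  scaleR_schwartz.rep_eq schwartz_scale.rep_eq schwartz_mult_id.rep_eq

lemma smooth_schwartz: "smooth (schwartz_apply f)"
  using schwartz_apply[of f] by simp

lemma schwartz_has_vector_derivative:
  "(schwartz_apply f has_vector_derivative schwartz_apply (schwartz_deriv f) x) (at x)"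
  using smooth_has_vector_derivative[OF smooth_schwartz, of 0 f x] by (simp add: schwartz_deriv.rep_eq)

lemma continuous_schwartz_apply: "continuous_on A (schwartz_apply f)"
  by (meson continuous_at_imp_continuous_on has_vector_derivative_continuous schwartz_has_vector_derivative)

lemma borel_measurable_schwartz [measurable]: "schwartz_apply f \<in> borel_measurable borel"
  by (rule borel_measurable_continuous_onI) (rule continuous_schwartz_apply)

lemma scaleR_eq_schwartz_scale: "r *\<^sub>R f = schwartz_scale (of_real r) f"
  by (rule schwartz_eqI) (simp add: schwartz_apply_simps scaleR_conv_of_real)

lemma schwartz_deriv_scaleR: "schwartz_deriv (r *\<^sub>R f) = r *\<^sub>R schwartz_deriv f"
  by (simp add: scaleR_eq_schwartz_scale schwartz_deriv_scale)

lemma schwartz_deriv_diff: "schwartz_deriv (f - g) = schwartz_deriv f - schwartz_deriv g"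
  using schwartz_deriv_lincomb[of f "-1" g] by simp

lemma schwartz_mult_id_scaleR: "schwartz_mult_id (r *\<^sub>R f) = r *\<^sub>R schwartz_mult_id f"
  by (simp add: scaleR_eq_schwartz_scale schwartz_mult_id_scale)

lemma schwartz_mult_id_diff: "schwartz_mult_id (f - g) = schwartz_mult_id f - schwartz_mult_id g"
  by (rule schwartz_eqI) (simp add: schwartz_apply_simps algebra_simps)

text \<open>The canonical commutation relation of position and differentiation.\<close>

lemma schwartz_deriv_mult_id: "schwartz_deriv (schwartz_mult_id f) = schwartz_mult_id (schwartz_deriv f) + f"
  by (rule schwartz_eqI)
    (use vderiv_mult_id[OF smooth_schwartz, of 1 f] in
      \<open>simp add: schwartz_apply_simps schwartz_deriv.rep_eq\<close>)

lemma schwartz_seminorm_leI: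
  assumes "\<And>x. \<bar>x\<bar> ^ k * cmod ((vderiv ^^ n) (schwartz_apply f) x) \<le> C"
  shows "schwartz_seminorm k n f \<le> C"
  unfolding schwartz_seminorm_def by (rule cSUP_least) (use assms in auto)

lemma schwartz_seminorm_nonneg: "0 \<le> schwartz_seminorm k n f"
  by (rule order.trans[OF _ schwartz_seminorm_upper[of 0]]) auto

lemma schwartz_seminorm_lincomb:
  "schwartz_seminorm k n (f + schwartz_scale c g)
    \<le> schwartz_seminorm k n f + cmod c * schwartz_seminorm k n g"
proof (rule schwartz_seminorm_leI)
  fix x
  let ?F = "(vderiv ^^ n) (schwartz_apply f) x" and ?G = "(vderiv ^^ n) (schwartz_apply g) x"
  have "schwartz_apply (f + schwartz_scale c g) = (\<lambda>x. schwartz_apply f x + c * schwartz_apply g x)"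
    by (simp add: schwartz_apply_simps)
  then have "\<bar>x\<bar> ^ k * cmod ((vderiv ^^ n) (schwartz_apply (f + schwartz_scale c g)) x)
      = \<bar>x\<bar> ^ k * cmod (?F + c * ?G)"
    by (simp add: vderiv_lincomb[OF smooth_schwartz smooth_schwartz])
  also have "\<dots> \<le> \<bar>x\<bar> ^ k * (cmod ?F + cmod c * cmod ?G)"
    by (intro mult_left_mono) (auto intro: order.trans[OF norm_triangle_ineq] simp: norm_mult)
  also have "\<dots> = \<bar>x\<bar> ^ k * cmod ?F + cmod c * (\<bar>x\<bar> ^ k * cmod ?G)"
    by (simp add: algebra_simps)
  also have "\<dots> \<le> schwartz_seminorm k n f + cmod c * schwartz_seminorm k n g"
    by (intro add_mono mult_left_mono schwartz_seminorm_upper) auto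
  finally show "\<bar>x\<bar> ^ k * cmod ((vderiv ^^ n) (schwartz_apply (f + schwartz_scale c g)) x)
      \<le> schwartz_seminorm k n f + cmod c * schwartz_seminorm k n g" .
qed

lemma schwartz_seminorm_zero: "schwartz_seminorm k n 0 = 0"
  by (rule antisym[OF schwartz_seminorm_leI schwartz_seminorm_nonneg]) (simp add: zero_schwartz.rep_eq)

lemma schwartz_seminorm_add:
  "schwartz_seminorm k n (f + g) \<le> schwartz_seminorm k n f + schwartz_seminorm k n g"
  using schwartz_seminorm_lincomb[of k n f 1 g] by simp

lemma schwartz_seminorm_diff:
  "schwartz_seminorm k n (f - g) \<le> schwartz_seminorm k n f + schwartz_seminorm k n g"
  using schwartz_seminorm_lincomb[of k n f "-1" g] by simp

lemma schwartz_seminorm_scale: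
  "schwartz_seminorm k n (schwartz_scale c f) \<le> cmod c * schwartz_seminorm k n f"
  using schwartz_seminorm_lincomb[of k n 0 c f] by (simp add: schwartz_seminorm_zero)

lemma schwartz_seminorm_scaleR:
  "schwartz_seminorm k n (r *\<^sub>R f) \<le> \<bar>r\<bar> * schwartz_seminorm k n f"
  using schwartz_seminorm_scale[of k n "of_real r" f] by (simp add: scaleR_eq_schwartz_scale)

text \<open>
  The seminorms of order at most \<open>N\<close>, added up: an increasing sequence of norms that defines the
  topology of the Schwartz space.
\<close>

definition schwartz_norm :: "nat \<Rightarrow> schwartz \<Rightarrow> real"
  where "schwartz_norm N f = (\<Sum>k\<le>N. \<Sum>n\<le>N. schwartz_seminorm k n f)"

lemma schwartz_norm_nonneg: "0 \<le> schwartz_norm N f"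
  unfolding schwartz_norm_def by (intro sum_nonneg schwartz_seminorm_nonneg)

lemma schwartz_seminorm_le_norm:
  assumes "k \<le> N" "n \<le> N"
  shows "schwartz_seminorm k n f \<le> schwartz_norm N f"
proof -
  have "schwartz_seminorm k n f \<le> (\<Sum>n\<le>N. schwartz_seminorm k n f)"
    by (rule member_le_sum) (use assms schwartz_seminorm_nonneg in auto)
  also have "\<dots> \<le> schwartz_norm N f"
    unfolding schwartz_norm_def
    by (rule member_le_sum[where f = "\<lambda>k. \<Sum>n\<le>N. schwartz_seminorm k n f"])
      (use assms schwartz_seminorm_nonneg in \<open>auto intro: sum_nonneg\<close>)
  finally show ?thesis .
qed

lemma schwartz_norm_leI:
  assumes "\<And>k n. k \<le> N \<Longrightarrow> n \<le> N \<Longrightarrow> schwartz_seminorm k n f \<le> C"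
  shows "schwartz_norm N f \<le> (real N + 1)^2 * C"
proof -
  have "schwartz_norm N f \<le> (\<Sum>k\<le>N. \<Sum>n\<le>N. C)"
    unfolding schwartz_norm_def by (intro sum_mono) (use assms in auto)
  then show ?thesis
    by (simp add: power2_eq_square algebra_simps)
qed

lemma schwartz_norm_add: "schwartz_norm N (f + g) \<le> schwartz_norm N f + schwartz_norm N g"
  unfolding schwartz_norm_def sum.distrib[symmetric]
  by (intro sum_mono schwartz_seminorm_add)

lemma schwartz_norm_diff: "schwartz_norm N (f - g) \<le> schwartz_norm N f + schwartz_norm N g"
  unfolding schwartz_norm_def sum.distrib[symmetric]
  by (intro sum_mono schwartz_seminorm_diff)

lemma schwartz_norm_scale: "schwartz_norm N (schwartz_scale c f) \<le> cmod c * schwartz_norm N f"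
  unfolding schwartz_norm_def sum_distrib_left
  by (intro sum_mono schwartz_seminorm_scale)

lemma schwartz_norm_scaleR: "schwartz_norm N (r *\<^sub>R f) \<le> \<bar>r\<bar> * schwartz_norm N f"
  using schwartz_norm_scale[of N "of_real r" f] by (simp add: scaleR_eq_schwartz_scale)

lemma schwartz_norm_mono: "M \<le> N \<Longrightarrow> schwartz_norm M f \<le> schwartz_norm N f"
  unfolding schwartz_norm_def
  by (intro order.trans[OF sum_mono sum_mono2] sum_mono2 sum_nonneg schwartz_seminorm_nonneg) auto

lemma schwartz_norm_deriv:
  "schwartz_norm N (schwartz_deriv f) \<le> (real N + 1)^2 * schwartz_norm (Suc N) f"
  by (rule schwartz_norm_leI) (auto simp: schwartz_seminorm_deriv intro: schwartz_seminorm_le_norm)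

lemma schwartz_norm_mult_id:
  "schwartz_norm N (schwartz_mult_id f) \<le> (real N + 1)^3 * schwartz_norm (Suc N) f"
proof -
  have "schwartz_norm N (schwartz_mult_id f) \<le> (real N + 1)^2 * ((real N + 1) * schwartz_norm (Suc N) f)"
  proof (rule schwartz_norm_leI)
    fix k n assume kn: "k \<le> N" "n \<le> N"
    have "schwartz_seminorm k n (schwartz_mult_id f)
        \<le> schwartz_seminorm (Suc k) n f + real n * schwartz_seminorm k (n - 1) f"
      by (rule schwartz_seminorm_mult_id)
    also have "\<dots> \<le> schwartz_norm (Suc N) f + real N * schwartz_norm (Suc N) f"
      using kn by (intro add_mono mult_mono schwartz_seminorm_le_norm schwartz_seminorm_nonneg) auto
    finally show "schwartz_seminorm k n (schwartz_mult_id f) \<le> (real N + 1) * schwartz_norm (Suc N) f"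
      by (simp add: algebra_simps)
  qed
  then show ?thesis
    by (simp add: eval_nat_numeral algebra_simps)
qed

lemma schwartz_bounded_norm:
  assumes "schwartz_bounded B"
  obtains C where "\<And>f. f \<in> B \<Longrightarrow> schwartz_norm N f \<le> C"
proof -
  from assms obtain C where C: "\<And>k n f. f \<in> B \<Longrightarrow> schwartz_seminorm k n f \<le> C k n"
    unfolding schwartz_bounded_def by metis
  then have "schwartz_norm N f \<le> (\<Sum>k\<le>N. \<Sum>n\<le>N. C k n)" if "f \<in> B" for f
    unfolding schwartz_norm_def by (intro sum_mono) (use that in auto)
  then show ?thesis using that by blast
qed

text \<open>
  A linear functional is continuous iff it is bounded by a multiple of one of the norms; the converse
  direction is stated for tempered distributions.
\<close>

lemma continuous_on_schwartz_functionalI: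
  fixes u :: "schwartz \<Rightarrow> complex"
  assumes diff: "\<And>f g. u (f - g) = u f - u g"
    and bound: "\<And>f. cmod (u f) \<le> C * schwartz_norm N f"
  shows "continuous_on UNIV u"
proof -
  have "open (u -` U)" if U: "open U" for U
    unfolding open_schwartz_def
  proof
    fix f assume f: "f \<in> u -` U"
    then obtain e where e: "e > 0" "\<And>z. cmod (z - u f) < e \<Longrightarrow> z \<in> U"
      using U by (auto simp: open_dist dist_norm)
    define K where "K = (\<bar>C\<bar> + 1) * (real N + 1)^2"
    have K: "K > 0" unfolding K_def by (intro mult_pos_pos) auto
    have "g \<in> u -` U" if g: "\<forall>k\<le>N. \<forall>n\<le>N. schwartz_seminorm k n (g - f) < e / (2 * K)" for g
    proof -
      have "cmod (u g - u f) \<le> C * schwartz_norm N (g - f)"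
        using bound[of "g - f"] by (simp add: diff)
      also have "\<dots> \<le> (\<bar>C\<bar> + 1) * schwartz_norm N (g - f)"
        by (intro mult_right_mono schwartz_norm_nonneg) auto
      also have "\<dots> \<le> (\<bar>C\<bar> + 1) * ((real N + 1)^2 * (e / (2 * K)))"
        by (intro mult_left_mono schwartz_norm_leI) (use g in \<open>auto intro: less_imp_le\<close>)
      also have "\<dots> = e / 2"
        using K by (simp add: K_def field_simps)
      also have "\<dots> < e" using e by simp
      finally show ?thesis using e(2) by simp
    qed
    moreover have "e / (2 * K) > 0" using e K by simp
    ultimately show "\<exists>N. \<exists>e>0. \<forall>g.
        (\<forall>k\<le>N. \<forall>n\<le>N. schwartz_seminorm k n (g - f) < e) \<longrightarrow> g \<in> u -` U"
      by blast
  qed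
  then show ?thesis by (simp add: continuous_on_open_vimage)
qed

lemma tempered_apply_add: "tempered_apply u (f + g) = tempered_apply u f + tempered_apply u g"
  and tempered_apply_schwartz_scale: "tempered_apply u (schwartz_scale c f) = c * tempered_apply u f"
  and continuous_tempered_apply: "continuous_on UNIV (tempered_apply u)"
  using tempered_apply[of u] by auto

lemma tempered_apply_scaleR: "tempered_apply u (r *\<^sub>R f) = r *\<^sub>R tempered_apply u f"
  by (simp add: scaleR_eq_schwartz_scale tempered_apply_schwartz_scale scaleR_conv_of_real)

lemma tempered_apply_zero: "tempered_apply u 0 = 0"
  using tempered_apply_schwartz_scale[of u 0 0] by simp

lemma tempered_apply_diff: "tempered_apply u (f - g) = tempered_apply u f - tempered_apply u g"
  using tempered_apply_add[of u f "schwartz_scale (-1) g"] tempered_apply_schwartz_scale[of u "-1" g]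
  by simp

lemma tempered_apply_sum: "tempered_apply u (\<Sum>i\<in>I. f i) = (\<Sum>i\<in>I. tempered_apply u (f i))"
  by (induction I rule: infinite_finite_induct) (simp_all add: tempered_apply_zero tempered_apply_add)

lemma tempered_bounded:
  obtains N C where "C > 0" "\<And>f. cmod (tempered_apply u f) \<le> C * schwartz_norm N f"
proof -
  have "open (tempered_apply u -` ball 0 1)"
    using continuous_tempered_apply[of u] by (simp add: continuous_on_open_vimage)
  moreover have "0 \<in> tempered_apply u -` ball 0 1"
    by (simp add: tempered_apply_zero)
  ultimately obtain N e where e: "e > 0"
    "\<And>g. (\<forall>k\<le>N. \<forall>n\<le>N. schwartz_seminorm k n (g - 0) < e) \<Longrightarrow> g \<in> tempered_apply u -` ball 0 1"
    unfolding open_schwartz_def by meson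
  have small: "cmod (tempered_apply u g) < 1" if "schwartz_norm N g < e" for g
  proof -
    have "g \<in> tempered_apply u -` ball 0 1"
      by (rule e(2)) (use that in \<open>auto intro: order.strict_trans1[OF schwartz_seminorm_le_norm]\<close>)
    then show ?thesis by (simp add: dist_norm)
  qed
  have "cmod (tempered_apply u f) \<le> 2 / e * schwartz_norm N f" for f
  proof (rule field_le_epsilon)
    fix d :: real assume d: "d > 0"
    define s where "s = schwartz_norm N f + d * e / 2"
    have s: "s > 0" unfolding s_def using schwartz_norm_nonneg[of N f] d e by (simp add: add_nonneg_pos)
    define r where "r = e / (2 * s)"
    have r: "r > 0" using s e by (simp add: r_def)
    have "schwartz_norm N (r *\<^sub>R f) \<le> r * schwartz_norm N f"
      using schwartz_norm_scaleR[of N r f] r by simp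
    also have "\<dots> \<le> r * s"
      using r d e by (intro mult_left_mono) (auto simp: s_def)
    also have "\<dots> = e / 2" using s by (simp add: r_def)
    also have "\<dots> < e" using e by simp
    finally have "cmod (tempered_apply u (r *\<^sub>R f)) < 1" by (rule small)
    then have "r * cmod (tempered_apply u f) < 1"
      using r by (simp add: tempered_apply_scaleR)
    then have "cmod (tempered_apply u f) < 2 * s / e"
      using s e by (simp add: r_def field_simps)
    also have "\<dots> = 2 / e * schwartz_norm N f + d"
      using e by (simp add: s_def field_simps)
    finally show "cmod (tempered_apply u f) \<le> 2 / e * schwartz_norm N f + d" by simp
  qed
  with e(1) show ?thesis by (intro that[of "2 / e" N]) auto
qed

section \<open>The bilinear pairing of Schwartz functions\<close>

lemma isCont_schwartz_apply: "isCont (schwartz_apply f) x"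
  using continuous_schwartz_apply[of UNIV f] by (simp add: continuous_on_eq_continuous_at)

lemma schwartz_apply_bound: "cmod (schwartz_apply f x) \<le> schwartz_seminorm 0 0 f"
  using schwartz_seminorm_upper[of x 0 0 f] by simp

lemma schwartz_apply_decay:
  "cmod (schwartz_apply f x) \<le> 2 * schwartz_norm 2 f * inverse (1 + x\<^sup>2)"
proof -
  have "(1 + x\<^sup>2) * cmod (schwartz_apply f x) \<le> schwartz_seminorm 0 0 f + schwartz_seminorm 2 0 f"
    using schwartz_seminorm_upper[of x 0 0 f] schwartz_seminorm_upper[of x 2 0 f]
    by (simp add: algebra_simps)
  also have "\<dots> \<le> schwartz_norm 2 f + schwartz_norm 2 f"
    by (intro add_mono schwartz_seminorm_le_norm) auto
  finally have "cmod (schwartz_apply f x) * (1 + x\<^sup>2) \<le> 2 * schwartz_norm 2 f"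
    by (simp add: mult.commute)
  moreover have "1 + x\<^sup>2 > 0" by (simp add: add_pos_nonneg)
  ultimately show ?thesis by (simp add: pos_le_divide_eq flip: divide_inverse)
qed

lemma integrable_inverse_1_plus_square_real: "integrable lborel (\<lambda>x::real. inverse (1 + x\<^sup>2))"
  and integral_inverse_1_plus_square_real: "(\<integral>x. inverse (1 + x\<^sup>2) \<partial>lborel) = pi"
  using integrable_inverse_1_plus_square LBINT_inverse_1_plus_square
  by (simp_all add: set_integrable_def interval_lebesgue_integral_def set_lebesgue_integral_def)

lemma integrable_schwartz_times_bounded:
  fixes g :: "real \<Rightarrow> complex"
  assumes [measurable]: "g \<in> borel_measurable borel" and g: "\<And>x. cmod (g x) \<le> B"
  shows "integrable lborel (\<lambda>x. schwartz_apply f x * g x)"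
    and "cmod (\<integral>x. schwartz_apply f x * g x \<partial>lborel) \<le> 2 * pi * B * schwartz_norm 2 f"
proof -
  let ?C = "2 * schwartz_norm 2 f * B"
  have int: "integrable lborel (\<lambda>x. ?C * inverse (1 + x\<^sup>2))"
    by (intro integrable_mult_right integrable_inverse_1_plus_square_real)
  have le: "cmod (schwartz_apply f x * g x) \<le> ?C * inverse (1 + x\<^sup>2)" for x
  proof -
    have "cmod (schwartz_apply f x * g x) \<le> (2 * schwartz_norm 2 f * inverse (1 + x\<^sup>2)) * B"
      unfolding norm_mult
      by (intro mult_mono schwartz_apply_decay g) (auto intro!: mult_nonneg_nonneg schwartz_norm_nonneg)
    then show ?thesis by (simp add: mult_ac)
  qed
  show *: "integrable lborel (\<lambda>x. schwartz_apply f x * g x)"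
    by (rule Bochner_Integration.integrable_bound[OF int])
      (auto intro!: AE_I2 order.trans[OF le])
  have "cmod (\<integral>x. schwartz_apply f x * g x \<partial>lborel) \<le> (\<integral>x. cmod (schwartz_apply f x * g x) \<partial>lborel)"
    by (rule integral_norm_bound)
  also have "\<dots> \<le> (\<integral>x. ?C * inverse (1 + x\<^sup>2) \<partial>lborel)"
    by (intro integral_mono int integrable_norm * le)
  also have "\<dots> = 2 * pi * B * schwartz_norm 2 f"
    by (simp add: integral_inverse_1_plus_square_real)
  finally show "cmod (\<integral>x. schwartz_apply f x * g x \<partial>lborel) \<le> 2 * pi * B * schwartz_norm 2 f" .
qed

text \<open>
  The pairing is bilinear, not sesquilinear: no conjugation is involved.  On the Hermite functions, which
  are real-valued, it agrees with the inner product of \<open>L\<^sup>2\<close>.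
\<close>

definition schwartz_pairing :: "schwartz \<Rightarrow> schwartz \<Rightarrow> complex"
  where "schwartz_pairing f g = (\<integral>x. schwartz_apply f x * schwartz_apply g x \<partial>lborel)"

lemma integrable_schwartz_mult: "integrable lborel (\<lambda>x. schwartz_apply f x * schwartz_apply g x)"
  by (rule integrable_schwartz_times_bounded(1)[OF _ schwartz_apply_bound]) simp

lemma schwartz_pairing_bound:
  assumes "\<And>x. cmod (schwartz_apply g x) \<le> B"
  shows "cmod (schwartz_pairing f g) \<le> 2 * pi * B * schwartz_norm 2 f"
  unfolding schwartz_pairing_def by (rule integrable_schwartz_times_bounded(2)[OF _ assms]) simp

lemma schwartz_pairing_commute: "schwartz_pairing f g = schwartz_pairing g f"
  by (simp add: schwartz_pairing_def mult.commute)

lemma schwartz_pairing_add_left: "schwartz_pairing (f + g) h = schwartz_pairing f h + schwartz_pairing g h"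
  by (simp add: schwartz_pairing_def schwartz_apply_simps distrib_right integrable_schwartz_mult)

lemma schwartz_pairing_diff_left: "schwartz_pairing (f - g) h = schwartz_pairing f h - schwartz_pairing g h"
  by (simp add: schwartz_pairing_def schwartz_apply_simps left_diff_distrib integrable_schwartz_mult)

lemma schwartz_pairing_scale_left: "schwartz_pairing (schwartz_scale c f) h = c * schwartz_pairing f h"
  by (simp add: schwartz_pairing_def schwartz_apply_simps mult.assoc)

lemma schwartz_pairing_scaleR_left: "schwartz_pairing (r *\<^sub>R f) h = of_real r * schwartz_pairing f h"
  by (simp add: scaleR_eq_schwartz_scale schwartz_pairing_scale_left)

lemma schwartz_pairing_add_right: "schwartz_pairing h (f + g) = schwartz_pairing h f + schwartz_pairing h g"
  by (metis schwartz_pairing_add_left schwartz_pairing_commute)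

lemma schwartz_pairing_diff_right: "schwartz_pairing h (f - g) = schwartz_pairing h f - schwartz_pairing h g"
  by (metis schwartz_pairing_diff_left schwartz_pairing_commute)

lemma schwartz_pairing_scaleR_right: "schwartz_pairing h (r *\<^sub>R f) = of_real r * schwartz_pairing h f"
  by (metis schwartz_pairing_scaleR_left schwartz_pairing_commute)

lemma schwartz_pairing_mult_id:
  "schwartz_pairing (schwartz_mult_id f) g = schwartz_pairing f (schwartz_mult_id g)"
  by (simp add: schwartz_pairing_def schwartz_apply_simps mult_ac)

lemma schwartz_mult_tendsto_0_at_infinity:
  "((\<lambda>x. schwartz_apply f x * schwartz_apply g x) \<longlongrightarrow> 0) at_infinity"
proof (rule tendsto_0_le[OF tendsto_inverse_0[where 'a = real]])
  have "cmod (schwartz_apply f x * schwartz_apply g x)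
      \<le> norm (inverse x) * (schwartz_seminorm 1 0 f * schwartz_seminorm 0 0 g)" if "x \<noteq> 0" for x
  proof -
    have "\<bar>x\<bar> * cmod (schwartz_apply f x * schwartz_apply g x)
        = (\<bar>x\<bar> ^ 1 * cmod ((vderiv ^^ 0) (schwartz_apply f) x)) * cmod (schwartz_apply g x)"
      by (simp add: norm_mult)
    also have "\<dots> \<le> schwartz_seminorm 1 0 f * schwartz_seminorm 0 0 g"
      by (intro mult_mono schwartz_seminorm_upper schwartz_apply_bound schwartz_seminorm_nonneg) auto
    finally show ?thesis using that by (simp add: field_simps)
  qed
  moreover have "eventually (\<lambda>x::real. x \<noteq> 0) at_infinity"
    unfolding eventually_at_infinity by (rule exI[of _ 1]) auto
  ultimately show "\<forall>\<^sub>F x in at_infinity. cmod (schwartz_apply f x * schwartz_apply g x)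
      \<le> norm (inverse x) * (schwartz_seminorm 1 0 f * schwartz_seminorm 0 0 g)"
    by (auto elim: eventually_mono)
qed

lemma schwartz_mult_has_vector_derivative:
  "((\<lambda>x. schwartz_apply f x * schwartz_apply g x) has_vector_derivative
    (schwartz_apply f x * schwartz_apply (schwartz_deriv g) x
      + schwartz_apply (schwartz_deriv f) x * schwartz_apply g x)) (at x)"
  by (intro has_vector_derivative_mult schwartz_has_vector_derivative)

lemma integrable_schwartz_mult_deriv:
  "integrable lborel (\<lambda>x. schwartz_apply f x * schwartz_apply (schwartz_deriv g) x
      + schwartz_apply (schwartz_deriv f) x * schwartz_apply g x)"
  by (intro Bochner_Integration.integrable_add integrable_schwartz_mult)

lemma schwartz_pairing_deriv:
  "schwartz_pairing (schwartz_deriv f) g = - schwartz_pairing f (schwartz_deriv g)"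
proof -
  let ?F' = "\<lambda>x. schwartz_apply f x * schwartz_apply (schwartz_deriv g) x
      + schwartz_apply (schwartz_deriv f) x * schwartz_apply g x"
  have "(LBINT x=-\<infinity>..\<infinity>. ?F' x) = 0 - 0"
  proof (rule interval_integral_FTC_integrable)
    show "isCont ?F' x" for x
      by (intro continuous_intros isCont_schwartz_apply)
    show "set_integrable lborel (einterval (-\<infinity>) \<infinity>) ?F'"
      using integrable_schwartz_mult_deriv by (simp add: set_integrable_def)
    show "(((\<lambda>y. schwartz_apply f y * schwartz_apply g y) \<circ> real_of_ereal) \<longlongrightarrow> 0) (at_right (- \<infinity>))"
      unfolding ereal_tendsto_simps
      by (rule tendsto_mono[OF at_bot_le_at_infinity schwartz_mult_tendsto_0_at_infinity])
    show "(((\<lambda>y. schwartz_apply f y * schwartz_apply g y) \<circ> real_of_ereal) \<longlongrightarrow> 0) (at_left \<infinity>)"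
      unfolding ereal_tendsto_simps
      by (rule tendsto_mono[OF at_top_le_at_infinity schwartz_mult_tendsto_0_at_infinity])
  qed (simp, rule schwartz_mult_has_vector_derivative)
  then have "(\<integral>x. ?F' x \<partial>lborel) = 0"
    by (simp add: interval_lebesgue_integral_def set_lebesgue_integral_def)
  then have "schwartz_pairing f (schwartz_deriv g) + schwartz_pairing (schwartz_deriv f) g = 0"
    unfolding schwartz_pairing_def by (simp add: integrable_schwartz_mult)
  then show ?thesis by (simp add: add_eq_0_iff)
qed

text \<open>
  The elementary Sobolev inequality on the line, from \<open>f(x)\<^sup>2 = 2 \<integral> f f'\<close> over the half-line left of
  \<open>x\<close>.
\<close>

lemma sobolev_inequality:
  "(cmod (schwartz_apply f x))\<^sup>2
    \<le> (\<integral>y. (cmod (schwartz_apply f y))\<^sup>2 + (cmod (schwartz_apply (schwartz_deriv f) y))\<^sup>2 \<partial>lborel)"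
proof -
  let ?f = "schwartz_apply f" and ?f' = "schwartz_apply (schwartz_deriv f)"
  let ?F' = "\<lambda>x. ?f x * ?f' x + ?f' x * ?f x"
  let ?S = "{..<x}"
  have "(LBINT y=-\<infinity>..ereal x. ?F' y) = ?f x * ?f x - 0"
  proof (rule interval_integral_FTC_integrable)
    show "isCont ?F' x" for x
      by (intro continuous_intros isCont_schwartz_apply)
    show "set_integrable lborel (einterval (-\<infinity>) (ereal x)) ?F'"
      unfolding set_integrable_def
      by (intro integrable_mult_indicator integrable_schwartz_mult_deriv) simp
    have "isCont (\<lambda>y. ?f y * ?f y) x"
      by (intro continuous_intros isCont_schwartz_apply)
    then show "(((\<lambda>y. ?f y * ?f y) \<circ> real_of_ereal) \<longlongrightarrow> ?f x * ?f x) (at_left (ereal x))"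
      unfolding ereal_tendsto_simps isCont_def by (rule tendsto_mono[OF at_le[OF subset_UNIV]])
    show "(((\<lambda>y. ?f y * ?f y) \<circ> real_of_ereal) \<longlongrightarrow> 0) (at_right (- \<infinity>))"
      unfolding ereal_tendsto_simps
      by (rule tendsto_mono[OF at_bot_le_at_infinity schwartz_mult_tendsto_0_at_infinity])
  qed (simp, rule schwartz_mult_has_vector_derivative)
  then have eq: "(\<integral>y. indicator ?S y *\<^sub>R ?F' y \<partial>lborel) = (?f x)\<^sup>2"
    unfolding interval_lebesgue_integral_def set_lebesgue_integral_def by (simp add: power2_eq_square)
  have sq: "integrable lborel (\<lambda>y. (cmod (schwartz_apply h y))\<^sup>2)" for h
    using integrable_norm[OF integrable_schwartz_mult[of h h]] by (simp add: norm_mult power2_eq_square)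
  have "(cmod (?f x))\<^sup>2 = cmod (\<integral>y. indicator ?S y *\<^sub>R ?F' y \<partial>lborel)"
    unfolding eq norm_power ..
  also have "\<dots> \<le> (\<integral>y. cmod (indicator ?S y *\<^sub>R ?F' y) \<partial>lborel)"
    by (rule integral_norm_bound)
  also have "\<dots> \<le> (\<integral>y. (cmod (?f y))\<^sup>2 + (cmod (?f' y))\<^sup>2 \<partial>lborel)"
  proof (rule integral_mono)
    show "integrable lborel (\<lambda>y. cmod (indicator ?S y *\<^sub>R ?F' y))"
      by (intro integrable_norm integrable_mult_indicator integrable_schwartz_mult_deriv) simp
    show "integrable lborel (\<lambda>y. (cmod (?f y))\<^sup>2 + (cmod (?f' y))\<^sup>2)"
      by (intro Bochner_Integration.integrable_add sq)
    fix y
    have "cmod (indicator ?S y *\<^sub>R ?F' y) \<le> cmod (?F' y)"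
      by (simp only: norm_scaleR) (simp add: indicator_def)
    also have "\<dots> = 2 * cmod (?f y) * cmod (?f' y)"
    proof -
      have "?F' y = 2 * (?f y * ?f' y)" by (simp add: mult.commute)
      then show ?thesis by (simp only: norm_mult norm_numeral mult.assoc)
    qed
    also have "\<dots> \<le> (cmod (?f y))\<^sup>2 + (cmod (?f' y))\<^sup>2"
      by (rule sum_squares_bound)
    finally show "cmod (indicator ?S y *\<^sub>R ?F' y) \<le> (cmod (?f y))\<^sup>2 + (cmod (?f' y))\<^sup>2" .
  qed
  finally show ?thesis .
qed

lemma sobolev_inequality_real:
  assumes "\<And>x. Im (schwartz_apply f x) = 0"
  shows "(cmod (schwartz_apply f x))\<^sup>2
    \<le> Re (schwartz_pairing f f) + Re (schwartz_pairing (schwartz_deriv f) (schwartz_deriv f))"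
proof -
  have sq: "(cmod (schwartz_apply h y))\<^sup>2 = Re (schwartz_apply h y * schwartz_apply h y)"
    if "\<And>x. Im (schwartz_apply h x) = 0" for h y
    using that[of y] unfolding cmod_power2 by (simp add: power2_eq_square)
  have "Im (schwartz_apply (schwartz_deriv f) x) = 0" for x
  proof -
    have "((\<lambda>x. Im (schwartz_apply f x)) has_vector_derivative Im (schwartz_apply (schwartz_deriv f) x)) (at x)"
      by (rule bounded_linear.has_vector_derivative[OF bounded_linear_Im schwartz_has_vector_derivative])
    then show ?thesis
      unfolding assms using has_vector_derivative_const vector_derivative_unique_at by blast
  qed
  note sq = sq[OF assms] sq[OF this]
  show ?thesis
    using sobolev_inequality[of f x]
    unfolding sq schwartz_pairing_def
    by (simp only: integral_Re[OF integrable_schwartz_mult] integrable_Re[OF integrable_schwartz_mult]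
        Bochner_Integration.integral_add)
qed

section \<open>The Gaussian\<close>

lemma power_div_fact_le_exp:
  fixes y :: real
  assumes "y \<ge> 0"
  shows "y ^ k / fact k \<le> exp y"
proof -
  have "(\<Sum>n\<in>{k}. y ^ n /\<^sub>R fact n) \<le> (\<Sum>n. y ^ n /\<^sub>R fact n)"
    by (rule sum_le_suminf[OF summable_exp_generic]) (use assms in auto)
  then show ?thesis
    by (simp add: exp_def scaleR_conv_of_real divide_inverse mult.commute)
qed

lemma power_mult_gaussian_bounded: "\<bar>x\<bar> ^ k * exp (- x\<^sup>2 / 2) \<le> (1 + 2 ^ k * fact k :: real)"
proof -
  have "\<bar>x\<bar> ^ k \<le> 1 + x ^ (2 * k)"
  proof (cases "\<bar>x\<bar> \<le> 1")
    case True
    then show ?thesis using power_le_one[of "\<bar>x\<bar>" k] by (simp add: add_increasing2)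
  next
    case False
    then have "\<bar>x\<bar> ^ k \<le> \<bar>x\<bar> ^ (2 * k)" by (intro power_increasing) auto
    then show ?thesis by (simp add: power_even_abs)
  qed
  also have "\<dots> \<le> exp (x\<^sup>2 / 2) + 2 ^ k * fact k * exp (x\<^sup>2 / 2)"
    using power_div_fact_le_exp[of "x\<^sup>2 / 2" k]
    by (intro add_mono) (simp_all add: power_mult power_divide field_simps del: power_mult_distrib flip: power_mult)
  finally have "\<bar>x\<bar> ^ k \<le> (1 + 2 ^ k * fact k) * exp (x\<^sup>2 / 2)"
    by (simp add: algebra_simps)
  then show ?thesis by (simp add: exp_minus field_simps)
qed

lemma poly_mult_gaussian_bounded:
  "\<exists>C. \<forall>x. \<bar>x\<bar> ^ k * \<bar>poly p x * exp (- x\<^sup>2 / 2)\<bar> \<le> (C::real)"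
proof (induction p arbitrary: k)
  case 0
  then show ?case by (auto intro: exI[of _ 0])
next
  case (pCons a p)
  obtain C where C: "\<And>x. \<bar>x\<bar> ^ Suc k * \<bar>poly p x * exp (- x\<^sup>2 / 2)\<bar> \<le> C"
    using pCons by blast
  have "\<bar>x\<bar> ^ k * \<bar>poly (pCons a p) x * exp (- x\<^sup>2 / 2)\<bar> \<le> \<bar>a\<bar> * (1 + 2 ^ k * fact k) + C" for x
  proof -
    have "\<bar>x\<bar> ^ k * \<bar>poly (pCons a p) x * exp (- x\<^sup>2 / 2)\<bar>
        \<le> \<bar>x\<bar> ^ k * (\<bar>a * exp (- x\<^sup>2 / 2)\<bar> + \<bar>x * poly p x * exp (- x\<^sup>2 / 2)\<bar>)"
      by (intro mult_left_mono) (auto simp: distrib_right intro: abs_triangle_ineq)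
    also have "\<dots> = \<bar>a\<bar> * (\<bar>x\<bar> ^ k * exp (- x\<^sup>2 / 2)) + \<bar>x\<bar> ^ Suc k * \<bar>poly p x * exp (- x\<^sup>2 / 2)\<bar>"
      by (simp add: abs_mult algebra_simps)
    also have "\<dots> \<le> \<bar>a\<bar> * (1 + 2 ^ k * fact k) + C"
      by (intro add_mono mult_left_mono power_mult_gaussian_bounded C) auto
    finally show ?thesis .
  qed
  then show ?case by blast
qed

lemma poly_mult_gaussian_has_vector_derivative:
  "((\<lambda>x. complex_of_real (poly p x * exp (- x\<^sup>2 / 2))) has_vector_derivative
    of_real (poly (pderiv p - [:0, 1:] * p) x * exp (- x\<^sup>2 / 2))) (at x)"
  by (rule has_vector_derivative_of_real)
    (auto intro!: derivative_eq_intros simp: algebra_simps)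

lemma vderiv_gaussian:
  "\<exists>p. (vderiv ^^ n) (\<lambda>x. of_real (exp (- x\<^sup>2 / 2))) = (\<lambda>x. of_real (poly p x * exp (- x\<^sup>2 / 2)))"
proof (induction n)
  case 0
  show ?case by (rule exI[of _ 1]) simp
next
  case (Suc n)
  then obtain p where
    "(vderiv ^^ n) (\<lambda>x. of_real (exp (- x\<^sup>2 / 2))) = (\<lambda>x. of_real (poly p x * exp (- x\<^sup>2 / 2)))" by blast
  then show ?case
    using vderiv_eqI[OF poly_mult_gaussian_has_vector_derivative[of p]]
    by (intro exI[of _ "pderiv p - [:0, 1:] * p"]) (simp only: funpow.simps comp_apply)
qed

text \<open>The ground state \<open>exp(- x\<^sup>2 / 2)\<close>, which \<open>x + d/dx\<close> annihilates; it is not normalised.\<close>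

lift_definition gaussian :: schwartz is "\<lambda>x. of_real (exp (- x\<^sup>2 / 2))"
proof
  show "smooth (\<lambda>x. of_real (exp (- x\<^sup>2 / 2)))"
    unfolding smooth_def
  proof (intro allI)
    fix n x
    obtain p where "(vderiv ^^ n) (\<lambda>x. of_real (exp (- x\<^sup>2 / 2))) = (\<lambda>x. of_real (poly p x * exp (- x\<^sup>2 / 2)))"
      using vderiv_gaussian by blast
    then show "(vderiv ^^ n) (\<lambda>x. of_real (exp (- x\<^sup>2 / 2))) differentiable at x"
      using poly_mult_gaussian_has_vector_derivative[of p x] by (simp only: differentiableI_vector)
  qed
  show "rapidly_decreasing (\<lambda>x. of_real (exp (- x\<^sup>2 / 2)))"
    unfolding rapidly_decreasing_altdef
  proof (intro allI)
    fix k n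
    obtain p where p: "(vderiv ^^ n) (\<lambda>x. of_real (exp (- x\<^sup>2 / 2))) = (\<lambda>x. of_real (poly p x * exp (- x\<^sup>2 / 2)))"
      using vderiv_gaussian by blast
    show "\<exists>C. \<forall>x. \<bar>x\<bar> ^ k * cmod ((vderiv ^^ n) (\<lambda>x. of_real (exp (- x\<^sup>2 / 2))) x) \<le> C"
      unfolding p norm_of_real by (rule poly_mult_gaussian_bounded)
  qed
qed

lemma schwartz_deriv_gaussian: "schwartz_deriv gaussian = - schwartz_mult_id gaussian"
proof (rule schwartz_eqI)
  fix x
  have "vderiv (\<lambda>x. complex_of_real (exp (- x\<^sup>2 / 2))) = (\<lambda>x. of_real (- x * exp (- x\<^sup>2 / 2)))"
    using vderiv_eqI[OF poly_mult_gaussian_has_vector_derivative[of 1]] by simp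
  then show "schwartz_apply (schwartz_deriv gaussian) x = schwartz_apply (- schwartz_mult_id gaussian) x"
    by (simp add: schwartz_apply_simps schwartz_deriv.rep_eq gaussian.rep_eq)
qed

lemma gaussian_pairing_pos: "\<exists>r>0. schwartz_pairing gaussian gaussian = of_real r"
proof -
  have sq: "schwartz_apply gaussian x * schwartz_apply gaussian x = of_real (exp (- x\<^sup>2))" for x
    by (simp add: gaussian.rep_eq flip: of_real_mult exp_add)
  have int: "integrable lborel (\<lambda>x::real. exp (- x\<^sup>2))"
    using integrable_schwartz_mult[of gaussian gaussian] unfolding sq complex_of_real_integrable_eq .
  have "0 < (\<integral>x. indicator {0..1::real} x * exp (- 1 :: real) \<partial>lborel)"
    by simp
  also have "\<dots> \<le> (\<integral>x. exp (- x\<^sup>2) \<partial>lborel)"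
  proof (rule integral_mono[OF integrable_mult_left int])
    show "integrable lborel (indicator {0..1} :: real \<Rightarrow> real)"
      by (rule integrable_real_indicator) auto
  qed (auto simp: indicator_def power_le_one)
  finally show ?thesis
    by (intro exI[of _ "\<integral>x. exp (- x\<^sup>2) \<partial>lborel"]) (simp add: schwartz_pairing_def sq)
qed

section \<open>Hermite functions\<close>

text \<open>
  The operators \<open>x - d/dx\<close> and \<open>x + d/dx\<close>, that is, \<open>\<surd>2\<close> times the creation and the annihilation
  operator on Schwartz functions.
\<close>

definition raising :: "schwartz \<Rightarrow> schwartz"
  where "raising f = schwartz_mult_id f - schwartz_deriv f"

definition lowering :: "schwartz \<Rightarrow> schwartz"
  where "lowering f = schwartz_mult_id f + schwartz_deriv f"

lemma raising_scaleR: "raising (r *\<^sub>R f) = r *\<^sub>R raising f"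
  by (simp add: raising_def schwartz_mult_id_scaleR schwartz_deriv_scaleR scaleR_diff_right)

lemma lowering_scaleR: "lowering (r *\<^sub>R f) = r *\<^sub>R lowering f"
  by (simp add: lowering_def schwartz_mult_id_scaleR schwartz_deriv_scaleR scaleR_add_right)

lemma lowering_raising: "lowering (raising f) = raising (lowering f) + 2 *\<^sub>R f"
  by (simp add: lowering_def raising_def schwartz_mult_id_add schwartz_mult_id_diff
      schwartz_deriv_add schwartz_deriv_diff schwartz_deriv_mult_id scaleR_2)

lemma schwartz_pairing_raising: "schwartz_pairing (raising f) g = schwartz_pairing f (lowering g)"
  by (simp add: lowering_def raising_def schwartz_pairing_diff_left schwartz_pairing_add_right
      schwartz_pairing_mult_id schwartz_pairing_deriv)

lemma schwartz_pairing_lowering: "schwartz_pairing (lowering f) g = schwartz_pairing f (raising g)"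
  by (metis schwartz_pairing_raising schwartz_pairing_commute)

text \<open>
  The Hermite functions, normalised in \<open>L\<^sup>2\<close>.  Only the positivity of the integral of the squared Gaussian
  matters, so its value is left unevaluated.
\<close>

primrec hermite :: "nat \<Rightarrow> schwartz" where
  "hermite 0 = (1 / sqrt (Re (schwartz_pairing gaussian gaussian))) *\<^sub>R gaussian"
| "hermite (Suc n) = (1 / sqrt (2 * real (Suc n))) *\<^sub>R raising (hermite n)"

lemma raising_hermite: "raising (hermite n) = sqrt (2 * real (Suc n)) *\<^sub>R hermite (Suc n)"
  by simp

lemma lowering_hermite_0: "lowering (hermite 0) = 0"
  by (simp add: lowering_scaleR) (simp add: lowering_def schwartz_deriv_gaussian)

text \<open>At \<open>n = 0\<close> the coefficient vanishes, so the value of \<open>n - 1\<close> there is immaterial.\<close>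

lemma lowering_hermite: "lowering (hermite n) = sqrt (2 * real n) *\<^sub>R hermite (n - 1)"
proof (induction n)
  case 0
  show ?case using lowering_hermite_0 by simp
next
  case (Suc n)
  have "raising (lowering (hermite n)) = (2 * real n) *\<^sub>R hermite n"
    unfolding Suc raising_scaleR by (cases n) (simp_all add: raising_hermite del: hermite.simps)
  then have "lowering (raising (hermite n)) = (2 * real (Suc n)) *\<^sub>R hermite n"
    by (simp add: lowering_raising algebra_simps scaleR_2)
  then show ?case
    by (simp add: lowering_scaleR) (simp add: field_simps real_sqrt_mult flip: real_sqrt_mult)
qed

declare hermite.simps [simp del]

lemma raising_lowering_hermite: "raising (lowering (hermite n)) = (2 * real n) *\<^sub>R hermite n"
  unfolding lowering_hermite raising_scaleR by (cases n) (simp_all add: raising_hermite)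

lemma sqrt_double: "sqrt (2 * a) = 2 * sqrt (a / 2)"
  using real_sqrt_mult[of 4 "a / 2"] by simp

lemma schwartz_mult_id_hermite:
  "schwartz_mult_id (hermite n) =
    sqrt (real (Suc n) / 2) *\<^sub>R hermite (Suc n) + sqrt (real n / 2) *\<^sub>R hermite (n - 1)"
proof -
  have "2 *\<^sub>R schwartz_mult_id (hermite n) = raising (hermite n) + lowering (hermite n)"
    by (simp add: raising_def lowering_def scaleR_2)
  also have "\<dots> = 2 *\<^sub>R (sqrt (real (Suc n) / 2) *\<^sub>R hermite (Suc n) + sqrt (real n / 2) *\<^sub>R hermite (n - 1))"
    unfolding raising_hermite lowering_hermite sqrt_double by (simp add: scaleR_add_right)
  finally show ?thesis by (simp only: scaleR_cancel_left) simp
qed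

lemma schwartz_deriv_hermite:
  "schwartz_deriv (hermite n) =
    sqrt (real n / 2) *\<^sub>R hermite (n - 1) - sqrt (real (Suc n) / 2) *\<^sub>R hermite (Suc n)"
proof -
  have "2 *\<^sub>R schwartz_deriv (hermite n) = lowering (hermite n) - raising (hermite n)"
    by (simp add: raising_def lowering_def scaleR_2)
  also have "\<dots> = 2 *\<^sub>R (sqrt (real n / 2) *\<^sub>R hermite (n - 1) - sqrt (real (Suc n) / 2) *\<^sub>R hermite (Suc n))"
    unfolding raising_hermite lowering_hermite sqrt_double by (simp add: scaleR_diff_right)
  finally show ?thesis by (simp only: scaleR_cancel_left) simp
qed

lemma schwartz_pairing_hermite_0_0: "schwartz_pairing (hermite 0) (hermite 0) = 1"
proof -
  obtain r where "r > 0" "schwartz_pairing gaussian gaussian = of_real r"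
    using gaussian_pairing_pos by blast
  then show ?thesis
    by (simp add: hermite.simps schwartz_pairing_scaleR_left schwartz_pairing_scaleR_right flip: of_real_mult)
qed

lemma hermite_orthonormal: "schwartz_pairing (hermite m) (hermite n) = (if m = n then 1 else 0)"
proof (induction m arbitrary: n)
  case 0
  show ?case
  proof (cases n)
    case 0
    then show ?thesis using schwartz_pairing_hermite_0_0 by simp
  next
    case (Suc k)
    have "schwartz_pairing (hermite 0) (raising (hermite k)) = 0"
      using schwartz_pairing_scaleR_left[of 0 0]
      by (simp only: schwartz_pairing_lowering[symmetric] lowering_hermite_0) simp
    then show ?thesis
      using Suc by (simp add: hermite.simps schwartz_pairing_scaleR_right)
  qed
next
  case (Suc m)
  have "schwartz_pairing (hermite (Suc m)) (hermite n)
      = of_real (1 / sqrt (2 * real (Suc m))) * (of_real (sqrt (2 * real n)) * schwartz_pairing (hermite m) (hermite (n - 1)))"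
    by (simp only: hermite.simps(2) schwartz_pairing_scaleR_left schwartz_pairing_raising lowering_hermite
        schwartz_pairing_scaleR_right)
  also have "\<dots> = (if Suc m = n then 1 else 0)"
    unfolding Suc by (cases n) (auto simp flip: of_real_mult)
  finally show ?case .
qed

lemma Im_hermite: "Im (schwartz_apply (hermite n) x) = 0"
proof (induction n arbitrary: x)
  case 0
  show ?case by (simp add: hermite.simps schwartz_apply_simps gaussian.rep_eq)
next
  case (Suc n)
  have "((\<lambda>x. Im (schwartz_apply (hermite n) x)) has_vector_derivative Im (schwartz_apply (schwartz_deriv (hermite n)) x)) (at x)"
    by (rule bounded_linear.has_vector_derivative[OF bounded_linear_Im schwartz_has_vector_derivative])
  then have "Im (schwartz_apply (schwartz_deriv (hermite n)) x) = 0"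
    unfolding Suc using has_vector_derivative_const vector_derivative_unique_at by blast
  then show ?case
    by (simp add: hermite.simps raising_def schwartz_apply_simps Suc)
qed

lemma hermite_bound: "cmod (schwartz_apply (hermite n) x) \<le> real n + 2"
proof -
  have "schwartz_pairing (schwartz_deriv (hermite n)) (schwartz_deriv (hermite n))
      = of_real (real n / 2 + real (Suc n) / 2)"
  proof -
    have "n - 1 \<noteq> Suc n" by simp
    then have "schwartz_pairing (a *\<^sub>R hermite (n - 1) - b *\<^sub>R hermite (Suc n)) (a *\<^sub>R hermite (n - 1) - b *\<^sub>R hermite (Suc n))
        = of_real (a * a + b * b)" for a b
      by (simp add: schwartz_pairing_diff_left schwartz_pairing_diff_right
        schwartz_pairing_scaleR_left schwartz_pairing_scaleR_right hermite_orthonormal)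
    then show ?thesis unfolding schwartz_deriv_hermite by (simp only: real_sqrt_mult_self) simp
  qed
  then have "(cmod (schwartz_apply (hermite n) x))\<^sup>2 \<le> 1 + (real n / 2 + real (Suc n) / 2)"
    using sobolev_inequality_real[OF Im_hermite, of n x] by (simp add: hermite_orthonormal)
  also have "\<dots> \<le> (real n + 2)\<^sup>2"
    using zero_le_square[of "real n"] by (simp add: power2_eq_square field_simps)
  finally show ?thesis by (rule power2_le_imp_le) simp
qed

lemma hermite_seminorm_bound:
  "\<exists>C. \<forall>n. schwartz_seminorm k l (hermite n) \<le> C * (real n + 1) ^ (k + l + 1)"
proof -
  \<comment> \<open>Position and differentiation map \<open>h\<^sub>n\<close> to combinations of \<open>h\<^bsub>n+1\<^esub>\<close> and \<open>h\<^bsub>n-1\<^esub>\<close> with coefficients of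
    order \<open>\<surd>n\<close>, so that each of them costs at most one power of \<open>n\<close>.\<close>
  have step: "\<exists>C. \<forall>n. p (g n) \<le> C * (real n + 1) ^ Suc M"
    if g: "\<And>n. g n = a n *\<^sub>R hermite (Suc n) + b n *\<^sub>R hermite (n - 1)"
    and ab: "\<And>n. \<bar>a n\<bar> \<le> sqrt (real (Suc n) / 2)" "\<And>n. \<bar>b n\<bar> \<le> sqrt (real n / 2)"
    and p: "\<And>f g. p (f + g) \<le> p f + p g" "\<And>r f. p (r *\<^sub>R f) \<le> \<bar>r\<bar> * p f" "\<And>f. 0 \<le> (p f :: real)"
    and C: "\<exists>C. \<forall>n. p (hermite n) \<le> C * (real n + 1) ^ M" for p g a b M
  proof -
    obtain C where C: "\<And>n. p (hermite n) \<le> C * (real n + 1) ^ M" using C by blast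
    have C0: "C \<ge> 0" using C[of 0] p(3)[of "hermite 0"] by simp
    have "p (g n) \<le> (2 * 2 ^ M * C) * (real n + 1) ^ Suc M" for n
    proof -
      have s: "sqrt (real m / 2) \<le> real n + 1" if "m \<le> Suc n" for m
      proof (rule real_le_lsqrt)
        have "real m / 2 \<le> real n + 1" using that by simp
        also have "\<dots> \<le> (real n + 1)\<^sup>2" by (simp add: power2_eq_square)
        finally show "real m / 2 \<le> (real n + 1)\<^sup>2" .
      qed simp
      have "p (g n) \<le> \<bar>a n\<bar> * p (hermite (Suc n)) + \<bar>b n\<bar> * p (hermite (n - 1))"
        unfolding g by (intro order.trans[OF p(1)] add_mono p)
      also have "\<dots> \<le> (real n + 1) * (C * (2 * (real n + 1)) ^ M) + (real n + 1) * (C * (2 * (real n + 1)) ^ M)"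
      proof (intro add_mono mult_mono p)
        show "p (hermite (Suc n)) \<le> C * (2 * (real n + 1)) ^ M" "p (hermite (n - 1)) \<le> C * (2 * (real n + 1)) ^ M"
          by (rule order.trans[OF C]; intro mult_left_mono power_mono C0; simp)+
        show "\<bar>a n\<bar> \<le> real n + 1" "\<bar>b n\<bar> \<le> real n + 1"
          using order.trans[OF ab(1) s] order.trans[OF ab(2) s] by simp_all
      qed auto
      also have "\<dots> = (2 * 2 ^ M * C) * (real n + 1) ^ Suc M"
        unfolding power_mult_distrib by simp
      finally show ?thesis .
    qed
    then show ?thesis by blast
  qed
  have base: "\<exists>C. \<forall>n. schwartz_seminorm k 0 (hermite n) \<le> C * (real n + 1) ^ (k + 1)" for k
  proof (induction k)
    case 0
    have "schwartz_seminorm 0 0 (hermite n) \<le> 2 * (real n + 1) ^ 1" for n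
      by (rule schwartz_seminorm_leI) (auto intro: order.trans[OF hermite_bound])
    then show ?case by (intro exI[of _ 2]) simp
  next
    case (Suc k)
    have "\<exists>C. \<forall>n. schwartz_seminorm k 0 (schwartz_mult_id (hermite n)) \<le> C * (real n + 1) ^ Suc (k + 1)"
      by (rule step[where p = "schwartz_seminorm k 0" and a = "\<lambda>n. sqrt (real (Suc n) / 2)"
            and b = "\<lambda>n. sqrt (real n / 2)" and g = "\<lambda>n. schwartz_mult_id (hermite n)",
            OF schwartz_mult_id_hermite _ _ schwartz_seminorm_add schwartz_seminorm_scaleR
              schwartz_seminorm_nonneg Suc]) auto
    moreover have "schwartz_seminorm k 0 (schwartz_mult_id f) = schwartz_seminorm (Suc k) 0 f" for f
      unfolding schwartz_seminorm_def by (simp add: schwartz_mult_id.rep_eq norm_mult mult_ac)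
    ultimately show ?case by simp
  qed
  show ?thesis
  proof (induction l)
    case 0
    show ?case using base by simp
  next
    case (Suc l)
    have "\<exists>C. \<forall>n. schwartz_seminorm k l (schwartz_deriv (hermite n)) \<le> C * (real n + 1) ^ Suc (k + l + 1)"
      by (rule step[where a = "\<lambda>n. - sqrt (real (Suc n) / 2)" and b = "\<lambda>n. sqrt (real n / 2)"
            and p = "schwartz_seminorm k l" and g = "\<lambda>n. schwartz_deriv (hermite n)",
            OF _ _ _ schwartz_seminorm_add schwartz_seminorm_scaleR schwartz_seminorm_nonneg Suc])
        (auto simp: schwartz_deriv_hermite)
    then show ?case by (simp add: schwartz_seminorm_deriv)
  qed
qed

lemma hermite_norm_bound:
  obtains C where "C > 0" "\<And>n. schwartz_norm N (hermite n) \<le> C * (real n + 1) ^ (2 * N + 1)"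
proof -
  obtain C where C: "\<And>k l n. schwartz_seminorm k l (hermite n) \<le> C k l * (real n + 1) ^ (k + l + 1)"
    using hermite_seminorm_bound by metis
  have "schwartz_norm N (hermite n) \<le> (1 + (\<Sum>k\<le>N. \<Sum>l\<le>N. \<bar>C k l\<bar>)) * (real n + 1) ^ (2 * N + 1)" for n
  proof -
    have "schwartz_norm N (hermite n) \<le> (\<Sum>k\<le>N. \<Sum>l\<le>N. \<bar>C k l\<bar> * (real n + 1) ^ (2 * N + 1))"
      unfolding schwartz_norm_def
      by (intro sum_mono order.trans[OF C] mult_mono power_increasing) auto
    also have "\<dots> = (\<Sum>k\<le>N. \<Sum>l\<le>N. \<bar>C k l\<bar>) * (real n + 1) ^ (2 * N + 1)"
      by (simp only: sum_distrib_right)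
    also have "\<dots> \<le> (1 + (\<Sum>k\<le>N. \<Sum>l\<le>N. \<bar>C k l\<bar>)) * (real n + 1) ^ (2 * N + 1)"
      by (intro mult_right_mono) auto
    finally show ?thesis .
  qed
  then show ?thesis
    by (intro that[of "1 + (\<Sum>k\<le>N. \<Sum>l\<le>N. \<bar>C k l\<bar>)"]) (auto intro!: add_pos_nonneg sum_nonneg)
qed

section \<open>Hermite coefficients of Schwartz functions\<close>

abbreviation hermite_coeff :: "schwartz \<Rightarrow> nat \<Rightarrow> complex"
  where "hermite_coeff f n \<equiv> schwartz_pairing f (hermite n)"

text \<open>
  The operator \<open>(x\<^sup>2 - d\<^sup>2/dx\<^sup>2 + 1) / 2\<close>, whose eigenvalue at the \<open>n\<close>-th Hermite function is \<open>n + 1\<close>;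
  as it is symmetric, its powers turn into decay of the coefficients.
\<close>

definition number_op :: "schwartz \<Rightarrow> schwartz"
  where "number_op f = (1 / 2) *\<^sub>R raising (lowering f) + f"

lemma hermite_coeff_number_op: "hermite_coeff (number_op f) n = (of_nat n + 1) * hermite_coeff f n"
  by (simp add: number_op_def schwartz_pairing_add_left schwartz_pairing_scaleR_left schwartz_pairing_raising
      schwartz_pairing_lowering raising_lowering_hermite schwartz_pairing_scaleR_right algebra_simps)

lemma hermite_coeff_number_op_power:
  "hermite_coeff ((number_op ^^ m) f) n = (of_nat n + 1) ^ m * hermite_coeff f n"
  by (induction m) (simp_all add: hermite_coeff_number_op)

lemma schwartz_norm_raising: "schwartz_norm N (raising f) \<le> 2 * (real N + 1) ^ 3 * schwartz_norm (Suc N) f"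
  and schwartz_norm_lowering: "schwartz_norm N (lowering f) \<le> 2 * (real N + 1) ^ 3 * schwartz_norm (Suc N) f"
proof -
  have "(real N + 1) ^ 2 * schwartz_norm (Suc N) f \<le> (real N + 1) ^ 3 * schwartz_norm (Suc N) f"
    by (intro mult_right_mono power_increasing schwartz_norm_nonneg) auto
  then show "schwartz_norm N (raising f) \<le> 2 * (real N + 1) ^ 3 * schwartz_norm (Suc N) f"
    "schwartz_norm N (lowering f) \<le> 2 * (real N + 1) ^ 3 * schwartz_norm (Suc N) f"
    using schwartz_norm_diff[of N "schwartz_mult_id f" "schwartz_deriv f"]
      schwartz_norm_add[of N "schwartz_mult_id f" "schwartz_deriv f"]
      schwartz_norm_mult_id[of N f] schwartz_norm_deriv[of N f]
    unfolding raising_def lowering_def by linarith+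
qed

lemma schwartz_norm_number_op:
  "\<exists>C\<ge>0. \<forall>f. schwartz_norm N (number_op f) \<le> C * schwartz_norm (N + 2) f"
proof -
  let ?C = "2 * (real N + 1) ^ 3 * (2 * (real (Suc N) + 1) ^ 3)"
  have "schwartz_norm N (number_op f) \<le> (?C + 1) * schwartz_norm (N + 2) f" for f
  proof -
    have "schwartz_norm N (number_op f) \<le> \<bar>1 / 2\<bar> * schwartz_norm N (raising (lowering f)) + schwartz_norm N f"
      unfolding number_op_def by (intro order.trans[OF schwartz_norm_add] add_mono schwartz_norm_scaleR) simp
    also have "\<dots> \<le> schwartz_norm N (raising (lowering f)) + schwartz_norm N f"
      using schwartz_norm_nonneg[of N "raising (lowering f)"] by simp
    also have "schwartz_norm N (raising (lowering f)) \<le> 2 * (real N + 1) ^ 3 * schwartz_norm (Suc N) (lowering f)"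
      by (rule schwartz_norm_raising)
    also have "\<dots> \<le> 2 * (real N + 1) ^ 3 * (2 * (real (Suc N) + 1) ^ 3 * schwartz_norm (Suc (Suc N)) f)"
      by (intro mult_left_mono schwartz_norm_lowering) simp
    also have "\<dots> = ?C * schwartz_norm (N + 2) f" by simp
    also have "schwartz_norm N f \<le> schwartz_norm (N + 2) f" by (rule schwartz_norm_mono) simp
    finally show ?thesis by (simp add: distrib_right)
  qed
  then show ?thesis by (intro exI[of _ "?C + 1"]) auto
qed

lemma schwartz_norm_number_op_power:
  "\<exists>C\<ge>0. \<exists>M. \<forall>f. schwartz_norm N ((number_op ^^ m) f) \<le> C * schwartz_norm M f"
proof (induction m arbitrary: N)
  case 0
  show ?case by (intro exI[of _ 1] conjI exI[of _ N]) auto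
next
  case (Suc m)
  obtain C where C: "C \<ge> 0" "\<And>f. schwartz_norm N (number_op f) \<le> C * schwartz_norm (N + 2) f"
    using schwartz_norm_number_op by blast
  obtain D M where D: "D \<ge> 0" "\<And>f. schwartz_norm (N + 2) ((number_op ^^ m) f) \<le> D * schwartz_norm M f"
    using Suc by blast
  have "schwartz_norm N ((number_op ^^ Suc m) f) \<le> (C * D) * schwartz_norm M f" for f
    using order.trans[OF C(2)[of "(number_op ^^ m) f"] mult_left_mono[OF D(2)[of f] C(1)]] by (simp add: mult.assoc)
  then show ?case using C(1) D(1) by (intro exI[of _ "C * D"]) auto
qed

lemma hermite_coeff_decay:
  obtains C N where "C > 0" "\<And>f n. cmod (hermite_coeff f n) * (real n + 1) ^ m \<le> C * schwartz_norm N f"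
proof -
  obtain C N where C: "C \<ge> 0" "\<And>f. schwartz_norm 2 ((number_op ^^ Suc m) f) \<le> C * schwartz_norm N f"
    using schwartz_norm_number_op_power by blast
  have "cmod (hermite_coeff f n) * (real n + 1) ^ m \<le> (4 * pi * C + 1) * schwartz_norm N f" for f n
  proof -
    have "cmod (hermite_coeff f n) * (real n + 1) ^ m * (real n + 1) = cmod (hermite_coeff ((number_op ^^ Suc m) f) n)"
      using norm_of_nat[of "Suc n", where 'a = complex]
      unfolding hermite_coeff_number_op_power
      by (simp add: norm_mult norm_power add.commute)
    also have "\<dots> \<le> 2 * pi * (real n + 2) * schwartz_norm 2 ((number_op ^^ Suc m) f)"
      by (intro schwartz_pairing_bound hermite_bound)
    also have "\<dots> \<le> 2 * pi * (2 * (real n + 1)) * (C * schwartz_norm N f)"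
      by (intro mult_mono C schwartz_norm_nonneg) auto
    also have "\<dots> = (4 * pi * C) * schwartz_norm N f * (real n + 1)" by simp
    finally have "cmod (hermite_coeff f n) * (real n + 1) ^ m \<le> (4 * pi * C) * schwartz_norm N f"
      by (rule mult_right_le_imp_le) simp
    then show ?thesis using schwartz_norm_nonneg[of N f] by (simp add: distrib_right)
  qed
  then show ?thesis using C(1) by (intro that[of "4 * pi * C + 1" N]) (auto intro: add_nonneg_pos)
qed

lemma hermite_coeff_weighted_decay:
  obtains C N where "C > 0"
    "\<And>f n. cmod (hermite_coeff f n) * (real n + 1) ^ m \<le> C * schwartz_norm N f * inverse (real (Suc n) ^ 2)"
proof -
  obtain C N where C: "C > 0" "\<And>f n. cmod (hermite_coeff f n) * (real n + 1) ^ (m + 2) \<le> C * schwartz_norm N f"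
    using hermite_coeff_decay by metis
  have "cmod (hermite_coeff f n) * (real n + 1) ^ m \<le> C * schwartz_norm N f * inverse (real (Suc n) ^ 2)" for f n
  proof -
    have "real (Suc n) ^ 2 > 0" by simp
    moreover have "cmod (hermite_coeff f n) * (real n + 1) ^ m * real (Suc n) ^ 2 \<le> C * schwartz_norm N f"
      using C(2)[of f n] by (simp only: power_add mult.assoc of_nat_Suc add.commute[of 1 "real n"])
    ultimately have "cmod (hermite_coeff f n) * (real n + 1) ^ m \<le> C * schwartz_norm N f / real (Suc n) ^ 2"
      by (simp only: pos_le_divide_eq)
    then show ?thesis by (simp add: divide_inverse)
  qed
  then show ?thesis using C(1) that by blast
qed

lemma summable_inverse_Suc_square: "summable (\<lambda>n. inverse (real (Suc n) ^ 2))"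
  using inverse_power_summable[of 2, where 'a = real] by (subst summable_Suc_iff) simp

lemma summable_hermite_coeff: "summable (\<lambda>n. cmod (hermite_coeff f n) * (real n + 1) ^ m)"
proof -
  obtain C N where C: "\<And>f n. cmod (hermite_coeff f n) * (real n + 1) ^ m
      \<le> C * schwartz_norm N f * inverse (real (Suc n) ^ 2)"
    using hermite_coeff_weighted_decay by metis
  have "norm (cmod (hermite_coeff f n) * (real n + 1) ^ m)
      \<le> C * schwartz_norm N f * inverse (real (Suc n) ^ 2)" for n
    using C[of f n] by simp
  then show ?thesis
    by (rule summable_comparison_test'[OF summable_mult[OF summable_inverse_Suc_square], of 0])
qed

section \<open>Division of a Schwartz function at a zero\<close>

lemma schwartz_deriv_power_has_vector_derivative:
  "((vderiv ^^ n) (schwartz_apply f) has_vector_derivative (vderiv ^^ Suc n) (schwartz_apply f) x) (at x)"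
  by (rule smooth_has_vector_derivative[OF smooth_schwartz])

lemma continuous_schwartz_deriv_power: "continuous_on A ((vderiv ^^ n) (schwartz_apply f))"
  by (meson continuous_at_imp_continuous_on has_vector_derivative_continuous schwartz_deriv_power_has_vector_derivative)

text \<open>
  The quotient is \<open>g(x) = \<integral>\<^sub>0\<^sup>1 f'(a + t (x - a)) dt\<close>.  It is smooth by differentiation under the
  integral sign, and its derivatives decay since away from \<open>a\<close> they are controlled by those of \<open>f\<close> and
  by the preceding derivative of \<open>g\<close>, through Leibniz' rule for \<open>f = (id - a) g\<close>.
\<close>

lemma schwartz_division:
  assumes "schwartz_apply f a = 0"
  obtains g where "f = schwartz_mult_id g - a *\<^sub>R g"
proof -
  define D where "D n = (vderiv ^^ n) (schwartz_apply f)" for n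
  \<comment> \<open>\<open>G n\<close> is the \<open>n\<close>-th derivative of the quotient.\<close>
  define G where "G n x = integral {0..1} (\<lambda>t. t ^ n *\<^sub>R D (Suc n) (a + t * (x - a)))" for n x
  have D_deriv: "(D n has_vector_derivative D (Suc n) x) (at x)" for n x
    unfolding D_def by (rule schwartz_deriv_power_has_vector_derivative)
  have D_cont: "continuous_on A (D n)" for A n
    unfolding D_def by (rule continuous_schwartz_deriv_power)
  have inner: "((\<lambda>x. a + t * (x - a)) has_vector_derivative t) (at x)" for t x
    by (auto intro!: derivative_eq_intros simp: has_real_derivative_iff_has_vector_derivative[symmetric])
  have G_deriv: "(G n has_vector_derivative G (Suc n) x) (at x)" for n x
  proof -
    have "((\<lambda>x. integral (cbox 0 1) (\<lambda>t. t ^ n *\<^sub>R D (Suc n) (a + t * (x - a)))) has_vector_derivative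
        integral (cbox 0 1) (\<lambda>t. t ^ Suc n *\<^sub>R D (Suc (Suc n)) (a + t * (x - a)))) (at x within UNIV)"
    proof (rule leibniz_rule_vector_derivative)
      show "((\<lambda>x. t ^ n *\<^sub>R D (Suc n) (a + t * (x - a))) has_vector_derivative
          t ^ Suc n *\<^sub>R D (Suc (Suc n)) (a + t * (x - a))) (at x within UNIV)" for x t
        using bounded_linear.has_vector_derivative[OF bounded_linear_scaleR_right
            vector_diff_chain_at[OF inner[of t x] D_deriv[of "Suc n"]], of "t ^ n"]
        by (simp add: o_def mult.commute)
      show "(\<lambda>t. t ^ n *\<^sub>R D (Suc n) (a + t * (x - a))) integrable_on cbox 0 1" for x
        by (intro integrable_continuous continuous_intros continuous_on_compose2[OF D_cont[of UNIV]]) auto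
      show "continuous_on (UNIV \<times> cbox 0 1) (\<lambda>(x, t). t ^ Suc n *\<^sub>R D (Suc (Suc n)) (a + t * (x - a)))"
        unfolding split_beta by (intro continuous_intros continuous_on_compose2[OF D_cont[of UNIV]]) auto
    qed auto
    then show ?thesis by (simp add: G_def[abs_def])
  qed
  have vderiv_G: "(vderiv ^^ n) (G 0) = G n" for n
    by (induction n) (simp_all add: vderiv_eqI[OF G_deriv])
  have smooth_G: "smooth (G 0)"
    unfolding smooth_def vderiv_G using G_deriv by (auto intro: differentiableI_vector)
  have eq: "schwartz_apply f x = of_real x * G 0 x + (- of_real a) * G 0 x" for x
  proof -
    have "((\<lambda>t. (x - a) *\<^sub>R D 1 (a + t * (x - a))) has_integral D 0 (a + 1 * (x - a)) - D 0 (a + 0 * (x - a))) {0..1}"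
    proof (rule fundamental_theorem_of_calculus)
      fix t :: real
      have "((\<lambda>t. a + t * (x - a)) has_vector_derivative (x - a)) (at t)"
        by (auto intro!: derivative_eq_intros simp: has_real_derivative_iff_has_vector_derivative[symmetric])
      then have "((\<lambda>t. D 0 (a + t * (x - a))) has_vector_derivative (x - a) *\<^sub>R D 1 (a + t * (x - a))) (at t)"
        using vector_diff_chain_at[OF _ D_deriv[of 0]] by (simp add: o_def)
      then show "((\<lambda>t. D 0 (a + t * (x - a))) has_vector_derivative (x - a) *\<^sub>R D 1 (a + t * (x - a))) (at t within {0..1})"
        by (rule has_vector_derivative_at_within)
    qed simp
    then have "(x - a) *\<^sub>R G 0 x = schwartz_apply f x"
      using assms by (simp add: G_def D_def integral_unique flip: integral_cmul)
    then show ?thesis by (simp add: scaleR_conv_of_real algebra_simps)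
  qed
  have D_eq: "D n x = (of_real x - of_real a) * G n x + of_nat n * G (n - 1) x" for n x
  proof -
    have "schwartz_apply f = (\<lambda>x. of_real x * G 0 x + (- of_real a) * G 0 x)"
      by (rule ext) (rule eq)
    then show ?thesis
      unfolding D_def
      by (simp only: vderiv_lincomb[OF smooth_mult_id[OF smooth_G] smooth_G] vderiv_mult_id[OF smooth_G] vderiv_G)
        (simp add: algebra_simps)
  qed
  have bound: "\<exists>C. \<forall>x. \<bar>x\<bar> ^ k * cmod (G n x) \<le> C" for k n
  proof -
    have near: "\<exists>C. \<forall>x\<in>{a - 1..a + 1}. \<bar>x\<bar> ^ k * cmod (G n x) \<le> C" for n
    proof -
      have "continuous_on {a - 1..a + 1} (\<lambda>x. \<bar>x\<bar> ^ k * cmod (G n x))"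
        using G_deriv by (intro continuous_intros continuous_at_imp_continuous_on ballI)
          (auto intro: has_vector_derivative_continuous)
      then have "bounded ((\<lambda>x. \<bar>x\<bar> ^ k * cmod (G n x)) ` {a - 1..a + 1})"
        by (intro compact_imp_bounded compact_continuous_image) auto
      then show ?thesis by (fastforce simp: bounded_iff)
    qed
    have step: "\<exists>C. \<forall>x. \<bar>x\<bar> ^ k * cmod (G n x) \<le> C"
      if prev: "\<And>x. real n * (\<bar>x\<bar> ^ k * cmod (G (n - 1) x)) \<le> B" for n B
    proof -
      obtain C where C: "\<And>x. x \<in> {a - 1..a + 1} \<Longrightarrow> \<bar>x\<bar> ^ k * cmod (G n x) \<le> C"
        using near by blast
      have "\<bar>x\<bar> ^ k * cmod (G n x) \<le> schwartz_seminorm k n f + B" if x: "x \<notin> {a - 1..a + 1}" for x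
      proof -
        have "1 * cmod (G n x) \<le> cmod (of_real x - of_real a) * cmod (G n x)"
          using x by (intro mult_right_mono) (auto simp flip: of_real_diff)
        also have "\<dots> = cmod (D n x - of_nat n * G (n - 1) x)"
          by (simp add: D_eq norm_mult)
        also have "\<dots> \<le> cmod (D n x) + real n * cmod (G (n - 1) x)"
          by (rule order.trans[OF norm_triangle_ineq4]) (simp add: norm_mult)
        finally have "\<bar>x\<bar> ^ k * cmod (G n x) \<le> \<bar>x\<bar> ^ k * (cmod (D n x) + real n * cmod (G (n - 1) x))"
          by (intro mult_left_mono) auto
        also have "\<dots> = \<bar>x\<bar> ^ k * cmod (D n x) + real n * (\<bar>x\<bar> ^ k * cmod (G (n - 1) x))"
          by (simp add: algebra_simps)
        also have "\<dots> \<le> schwartz_seminorm k n f + B"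
          unfolding D_def by (intro add_mono schwartz_seminorm_upper prev)
        finally show ?thesis .
      qed
      with C have "\<bar>x\<bar> ^ k * cmod (G n x) \<le> max C (schwartz_seminorm k n f + B)" for x
        by (cases "x \<in> {a - 1..a + 1}") (auto simp: le_max_iff_disj)
      then show ?thesis by blast
    qed
    show ?thesis
    proof (induction n)
      case 0
      show ?case by (rule step[of 0 0]) simp
    next
      case (Suc n)
      then obtain C where C: "\<And>x. \<bar>x\<bar> ^ k * cmod (G n x) \<le> C" by blast
      show ?case
        by (rule step[of "Suc n" "real (Suc n) * C"]) (use C in \<open>auto intro: mult_left_mono\<close>)
    qed
  qed
  have "rapidly_decreasing (G 0)"
    unfolding rapidly_decreasing_altdef vderiv_G using bound by blast
  with smooth_G have apply_G: "schwartz_apply (Abs_schwartz (G 0)) = G 0"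
    by (simp add: Abs_schwartz_inverse)
  have "f = schwartz_mult_id (Abs_schwartz (G 0)) - a *\<^sub>R Abs_schwartz (G 0)"
    by (rule schwartz_eqI) (simp add: schwartz_apply_simps apply_G eq scaleR_conv_of_real)
  then show ?thesis by (rule that)
qed

section \<open>Completeness of the Hermite functions\<close>

lemma summable_hermite_series: "summable (\<lambda>n. hermite_coeff f n * schwartz_apply (hermite n) x)"
proof (rule summable_comparison_test'[where N = 0])
  show "summable (\<lambda>n. 2 * (cmod (hermite_coeff f n) * (real n + 1) ^ 1))"
    by (intro summable_mult summable_hermite_coeff)
  fix n
  have "norm (hermite_coeff f n * schwartz_apply (hermite n) x) \<le> cmod (hermite_coeff f n) * (2 * (real n + 1))"
    unfolding norm_mult by (intro mult_left_mono order.trans[OF hermite_bound]) auto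
  then show "norm (hermite_coeff f n * schwartz_apply (hermite n) x) \<le> 2 * (cmod (hermite_coeff f n) * (real n + 1) ^ 1)"
    by (simp add: algebra_simps)
qed

text \<open>
  Up to a boundary term, multiplication by \<open>x\<close> commutes with the partial sums of the Hermite
  expansion (the Christoffel--Darboux identity); hence it commutes with the full expansion.
\<close>

lemma hermite_series_mult_id:
  "(\<Sum>n. hermite_coeff (schwartz_mult_id f) n * schwartz_apply (hermite n) x)
    = of_real x * (\<Sum>n. hermite_coeff f n * schwartz_apply (hermite n) x)"
proof -
  define s where "s n = complex_of_real (sqrt (real n / 2))" for n
  define c where "c n = hermite_coeff f n" for n
  define h where "h n = schwartz_apply (hermite n) x" for n
  \<comment> \<open>By the three-term recurrence of the Hermite functions, the difference of the two partial sums
    telescopes to this boundary term.\<close>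
  define R where "R n = (case n of 0 \<Rightarrow> 0 | Suc n \<Rightarrow> s (Suc n) * (c (Suc n) * h n - c n * h (Suc n)))" for n
  have xc: "hermite_coeff (schwartz_mult_id f) n = s (Suc n) * c (Suc n) + s n * c (n - 1)" for n
    by (simp add: s_def c_def schwartz_pairing_mult_id schwartz_mult_id_hermite schwartz_pairing_add_right
        schwartz_pairing_scaleR_right)
  have xh: "of_real x * h n = s (Suc n) * h (Suc n) + s n * h (n - 1)" for n
    using arg_cong[OF schwartz_mult_id_hermite[of n], of "\<lambda>f. schwartz_apply f x"]
    by (simp add: h_def s_def schwartz_apply_simps scaleR_conv_of_real)
  have tel: "hermite_coeff (schwartz_mult_id f) n * h n - of_real x * (c n * h n) = R (Suc n) - R n" for n
  proof -
    have "hermite_coeff (schwartz_mult_id f) n * h n - of_real x * (c n * h n)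
        = (s (Suc n) * c (Suc n) + s n * c (n - 1)) * h n - c n * (of_real x * h n)"
      by (simp add: xc mult_ac)
    also have "\<dots> = R (Suc n) - R n"
      unfolding xh by (cases n) (simp_all add: R_def algebra_simps s_def)
    finally show ?thesis .
  qed
  have "R \<longlonglongrightarrow> 0"
  proof (subst filterlim_sequentially_Suc[symmetric], rule Lim_null_comparison)
    have s: "cmod (s (Suc n)) \<le> real n + 1" for n
    proof -
      have "sqrt (real (Suc n) / 2) \<le> real n + 1"
        by (rule real_le_lsqrt) (auto simp: power2_eq_square algebra_simps)
      then show ?thesis by (simp add: s_def)
    qed
    have "cmod (R (Suc n)) \<le> cmod (c (Suc n)) * (real (Suc n) + 1) ^ 2 + 3 * (cmod (c n) * (real n + 1) ^ 2)" for n
    proof -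
      have "cmod (R (Suc n)) \<le> (real n + 1) * (cmod (c (Suc n)) * (real n + 2) + cmod (c n) * (real (Suc n) + 2))"
        unfolding R_def nat.case norm_mult
      proof (intro mult_mono s)
        show "cmod (c (Suc n) * h n - c n * h (Suc n)) \<le> cmod (c (Suc n)) * (real n + 2) + cmod (c n) * (real (Suc n) + 2)"
          by (rule order.trans[OF norm_triangle_ineq4])
            (auto simp only: norm_mult h_def intro!: add_mono mult_left_mono hermite_bound norm_ge_zero)
      qed auto
      also have "\<dots> = cmod (c (Suc n)) * ((real n + 1) * (real n + 2)) + cmod (c n) * ((real n + 1) * (real n + 3))"
        by (simp add: algebra_simps)
      also have "\<dots> \<le> cmod (c (Suc n)) * (real (Suc n) + 1) ^ 2 + cmod (c n) * (3 * (real n + 1) ^ 2)"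
        by (intro add_mono mult_left_mono) (auto simp: power2_eq_square algebra_simps)
      finally show ?thesis by simp
    qed
    then show "\<forall>\<^sub>F n in sequentially. cmod (R (Suc n))
        \<le> cmod (c (Suc n)) * (real (Suc n) + 1) ^ 2 + 3 * (cmod (c n) * (real n + 1) ^ 2)"
      by (intro always_eventually allI)
    have "(\<lambda>n. cmod (c n) * (real n + 1) ^ 2) \<longlonglongrightarrow> 0"
      unfolding c_def by (rule summable_LIMSEQ_zero[OF summable_hermite_coeff])
    from tendsto_add[OF LIMSEQ_Suc[OF this] tendsto_mult_left[OF this, of 3]]
    show "(\<lambda>n. cmod (c (Suc n)) * (real (Suc n) + 1) ^ 2 + 3 * (cmod (c n) * (real n + 1) ^ 2)) \<longlonglongrightarrow> 0"
      by simp
  qed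
  from telescope_sums[OF this]
  have "(\<lambda>n. hermite_coeff (schwartz_mult_id f) n * h n - of_real x * (c n * h n)) sums 0"
    unfolding tel by (simp add: R_def)
  moreover have "(\<lambda>n. hermite_coeff (schwartz_mult_id f) n * h n - of_real x * (c n * h n)) sums
      ((\<Sum>n. hermite_coeff (schwartz_mult_id f) n * h n) - of_real x * (\<Sum>n. c n * h n))"
    unfolding c_def h_def by (intro sums_diff sums_mult summable_sums summable_hermite_series)
  ultimately show ?thesis
    unfolding c_def h_def using sums_unique2 by fastforce
qed

text \<open>
  Fix \<open>x\<close> and subtract from \<open>f\<close> the multiple of the Gaussian that agrees with it at \<open>x\<close>.  The rest is
  \<open>(id - x) g\<close> with \<open>g\<close> a Schwartz function, and its expansion vanishes at \<open>x\<close> because the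
  expansion commutes with multiplication by the identity.
\<close>

lemma hermite_series_sums:
  "(\<lambda>n. hermite_coeff f n * schwartz_apply (hermite n) x) sums schwartz_apply f x"
proof -
  let ?P = "\<lambda>f. \<Sum>n. hermite_coeff f n * schwartz_apply (hermite n) x"
  have h0: "schwartz_apply (hermite 0) x \<noteq> 0"
  proof -
    obtain r where "r > 0" "schwartz_pairing gaussian gaussian = of_real r"
      using gaussian_pairing_pos by blast
    then show ?thesis by (simp add: hermite.simps schwartz_apply_simps gaussian.rep_eq)
  qed
  define a where "a = schwartz_apply f x / schwartz_apply (hermite 0) x"
  have "schwartz_apply (f - schwartz_scale a (hermite 0)) x = 0"
    using h0 by (simp add: schwartz_apply_simps a_def)
  then obtain g where g: "f - schwartz_scale a (hermite 0) = schwartz_mult_id g - x *\<^sub>R g"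
    by (rule schwartz_division)
  then have f: "f = schwartz_scale a (hermite 0) + schwartz_mult_id g - x *\<^sub>R g"
    by (simp add: algebra_simps)
  have "?P f = (\<Sum>n. a * (hermite_coeff (hermite 0) n * schwartz_apply (hermite n) x)
      + hermite_coeff (schwartz_mult_id g) n * schwartz_apply (hermite n) x
      - of_real x * (hermite_coeff g n * schwartz_apply (hermite n) x))"
    by (subst f) (simp add: schwartz_pairing_add_left schwartz_pairing_diff_left schwartz_pairing_scale_left
        schwartz_pairing_scaleR_left algebra_simps)
  also have "\<dots> = a * ?P (hermite 0) + ?P (schwartz_mult_id g) - of_real x * ?P g"
    by (intro sums_unique[symmetric] sums_diff sums_add sums_mult summable_sums summable_hermite_series)
  also have "\<dots> = a * ?P (hermite 0)"
    by (simp add: hermite_series_mult_id)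
  also have "?P (hermite 0) = (\<Sum>n\<in>{0}. hermite_coeff (hermite 0) n * schwartz_apply (hermite n) x)"
    by (rule suminf_finite) (auto simp: hermite_orthonormal)
  also have "\<dots> = schwartz_apply (hermite 0) x"
    by (simp add: hermite_orthonormal)
  also have "a * schwartz_apply (hermite 0) x = schwartz_apply f x"
    using h0 by (simp add: a_def)
  finally show ?thesis
    using summable_sums[OF summable_hermite_series] by metis
qed

lemma summable_hermite_coeff_norm:
  "summable (\<lambda>n. cmod (hermite_coeff f n) * schwartz_norm N (hermite n))"
proof -
  obtain C where C: "C > 0" "\<And>n. schwartz_norm N (hermite n) \<le> C * (real n + 1) ^ (2 * N + 1)"
    using hermite_norm_bound by blast
  show ?thesis
  proof (rule summable_comparison_test'[where N = 0])
    show "summable (\<lambda>n. C * (cmod (hermite_coeff f n) * (real n + 1) ^ (2 * N + 1)))"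
      by (intro summable_mult summable_hermite_coeff)
    show "norm (cmod (hermite_coeff f n) * schwartz_norm N (hermite n))
        \<le> C * (cmod (hermite_coeff f n) * (real n + 1) ^ (2 * N + 1))" for n
      using mult_left_mono[OF C(2)[of n], of "cmod (hermite_coeff f n)"]
      by (simp add: schwartz_norm_nonneg abs_mult mult_ac)
  qed
qed

lemma cmod_vderiv_hermite_le:
  "cmod (hermite_coeff f n * (vderiv ^^ l) (schwartz_apply (hermite n)) x)
    \<le> cmod (hermite_coeff f n) * schwartz_norm l (hermite n)"
  unfolding norm_mult using schwartz_seminorm_upper[of x 0 l "hermite n"]
  by (intro mult_left_mono) (auto intro: order.trans[OF _ schwartz_seminorm_le_norm])

lemma hermite_series_vderiv_sums:
  "(\<lambda>n. hermite_coeff f n * (vderiv ^^ l) (schwartz_apply (hermite n)) x) sums (vderiv ^^ l) (schwartz_apply f) x"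
proof (induction l arbitrary: x)
  case 0
  show ?case using hermite_series_sums by simp
next
  case (Suc l)
  define F where "F l n x = hermite_coeff f n * (vderiv ^^ l) (schwartz_apply (hermite n)) x" for l n x
  have F_deriv: "(F l n has_derivative (\<lambda>h. h *\<^sub>R F (Suc l) n x)) (at x)" for n x
    using has_vector_derivative_mult_right[OF schwartz_deriv_power_has_vector_derivative]
    unfolding F_def[abs_def] has_vector_derivative_def .
  define g' where "g' x = (\<Sum>n. F (Suc l) n x)" for x
  have M: "cmod (F (Suc l) n x) \<le> cmod (hermite_coeff f n) * schwartz_norm (Suc l) (hermite n)" for n x
    unfolding F_def by (rule cmod_vderiv_hermite_le)
  have unif: "uniform_limit UNIV (\<lambda>n x. \<Sum>i<n. F (Suc l) i x) g' sequentially"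
    unfolding g'_def by (rule Weierstrass_m_test[OF M summable_hermite_coeff_norm])
  have "\<exists>g. \<forall>x\<in>UNIV. (\<lambda>n. F l n x) sums g x \<and> (g has_derivative (\<lambda>h. h *\<^sub>R g' x)) (at x within UNIV)"
  proof (rule has_derivative_series)
    fix e :: real assume "e > 0"
    then have "\<forall>\<^sub>F n in sequentially. \<forall>x\<in>UNIV. dist (\<Sum>i<n. F (Suc l) i x) (g' x) < e"
      using unif unfolding uniform_limit_iff by blast
    then show "\<forall>\<^sub>F n in sequentially. \<forall>x\<in>UNIV. \<forall>h. cmod ((\<Sum>i<n. h *\<^sub>R F (Suc l) i x) - h *\<^sub>R g' x) \<le> e * norm h"
    proof eventually_elim
      case (elim n)
      show ?case
      proof (intro ballI allI)
        fix x h :: real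
        have "cmod ((\<Sum>i<n. h *\<^sub>R F (Suc l) i x) - h *\<^sub>R g' x) = \<bar>h\<bar> * cmod ((\<Sum>i<n. F (Suc l) i x) - g' x)"
          by (simp flip: scaleR_sum_right scaleR_diff_right)
        also have "\<dots> \<le> \<bar>h\<bar> * e"
          using elim by (intro mult_left_mono) (auto simp: dist_norm less_imp_le)
        finally show "cmod ((\<Sum>i<n. h *\<^sub>R F (Suc l) i x) - h *\<^sub>R g' x) \<le> e * norm h"
          by (simp add: mult.commute)
      qed
    qed
  next
    show "(\<lambda>n. F l n 0) sums (vderiv ^^ l) (schwartz_apply f) 0"
      unfolding F_def by (rule Suc)
  qed (use F_deriv in auto)
  then obtain g where g: "\<And>x. (\<lambda>n. F l n x) sums g x" "\<And>x. (g has_vector_derivative g' x) (at x)"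
    by (auto simp: has_vector_derivative_def)
  have "g = (vderiv ^^ l) (schwartz_apply f)"
    using sums_unique2[OF g(1) Suc[folded F_def]] by blast
  with g(2) have "(vderiv ^^ Suc l) (schwartz_apply f) x = g' x"
    using vderiv_eqI[of g g'] by simp
  moreover have "summable (\<lambda>n. F (Suc l) n x)"
    by (rule summable_comparison_test'[OF summable_hermite_coeff_norm, of 0]) (rule M)
  ultimately show ?case
    unfolding g'_def using summable_sums by (simp add: F_def)
qed

lemma vderiv_partial_sum:
  fixes M :: nat
  shows "(vderiv ^^ l) (schwartz_apply (f - (\<Sum>n<M. schwartz_scale (c n) (g n)))) x
    = (vderiv ^^ l) (schwartz_apply f) x - (\<Sum>n<M. c n * (vderiv ^^ l) (schwartz_apply (g n)) x)"
proof (induction M)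
  case (Suc M)
  let ?f = "f - (\<Sum>n<M. schwartz_scale (c n) (g n))"
  have "schwartz_apply (f - (\<Sum>n<Suc M. schwartz_scale (c n) (g n)))
      = (\<lambda>x. schwartz_apply ?f x + (- c M) * schwartz_apply (g M) x)"
    by (simp add: schwartz_apply_simps algebra_simps)
  then have "(vderiv ^^ l) (schwartz_apply (f - (\<Sum>n<Suc M. schwartz_scale (c n) (g n)))) x
      = (vderiv ^^ l) (schwartz_apply ?f) x + (- c M) * (vderiv ^^ l) (schwartz_apply (g M)) x"
    by (simp only: vderiv_lincomb[OF smooth_schwartz smooth_schwartz])
  then show ?case by (simp add: Suc)
qed simp

lemma hermite_expansion_converges:
  "(\<lambda>M. schwartz_norm N (f - (\<Sum>n<M. schwartz_scale (hermite_coeff f n) (hermite n)))) \<longlonglongrightarrow> 0"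
proof -
  define b where "b n = cmod (hermite_coeff f n) * schwartz_norm N (hermite n)" for n
  have b: "summable b" unfolding b_def by (rule summable_hermite_coeff_norm)
  define S where "S M = (\<Sum>n<M. schwartz_scale (hermite_coeff f n) (hermite n))" for M
  have le: "schwartz_norm N (f - S M) \<le> (real N + 1)^2 * (suminf b - (\<Sum>n<M. b n))" for M
  proof (intro schwartz_norm_leI schwartz_seminorm_leI)
    fix k l x assume kl: "k \<le> N" "l \<le> N"
    define F where "F n = hermite_coeff f n * (vderiv ^^ l) (schwartz_apply (hermite n)) x" for n
    have F: "F sums (vderiv ^^ l) (schwartz_apply f) x"
      unfolding F_def by (rule hermite_series_vderiv_sums)
    have Fb: "\<bar>x\<bar> ^ k * cmod (F n) \<le> b n" for n
    proof -
      have "\<bar>x\<bar> ^ k * cmod (F n)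
          = cmod (hermite_coeff f n) * (\<bar>x\<bar> ^ k * cmod ((vderiv ^^ l) (schwartz_apply (hermite n)) x))"
        by (simp add: F_def norm_mult)
      also have "\<dots> \<le> b n"
        unfolding b_def using kl
        by (intro mult_left_mono order.trans[OF schwartz_seminorm_upper schwartz_seminorm_le_norm]) auto
      finally show ?thesis .
    qed
    have "(\<lambda>n. \<bar>x\<bar> ^ k *\<^sub>R F (n + M)) sums (\<bar>x\<bar> ^ k *\<^sub>R ((vderiv ^^ l) (schwartz_apply f) x - (\<Sum>n<M. F n)))"
      using F by (intro sums_scaleR_right) (simp add: sums_iff_shift)
    moreover have "(\<lambda>n. b (n + M)) sums (suminf b - (\<Sum>n<M. b n))"
      using b by (simp add: sums_iff_shift summable_sums)
    ultimately have "cmod (\<bar>x\<bar> ^ k *\<^sub>R ((vderiv ^^ l) (schwartz_apply f) x - (\<Sum>n<M. F n))) \<le> suminf b - (\<Sum>n<M. b n)"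
      by (rule norm_sums_le) (use Fb in simp)
    then show "\<bar>x\<bar> ^ k * cmod ((vderiv ^^ l) (schwartz_apply (f - S M)) x) \<le> suminf b - (\<Sum>n<M. b n)"
      unfolding S_def vderiv_partial_sum by (simp add: F_def)
  qed
  have "(\<lambda>M. (real N + 1)^2 * (suminf b - (\<Sum>n<M. b n))) \<longlonglongrightarrow> (real N + 1)^2 * (suminf b - suminf b)"
    by (intro tendsto_intros summable_LIMSEQ b)
  then have lim: "(\<lambda>M. (real N + 1)^2 * (suminf b - (\<Sum>n<M. b n))) \<longlonglongrightarrow> 0" by simp
  show ?thesis
    unfolding S_def[symmetric]
    by (rule Lim_null_comparison[OF _ lim]) (simp only: real_norm_def abs_of_nonneg schwartz_norm_nonneg le eventually_True)
qed

section \<open>Tempered distributions as sequences of Hermite coefficients\<close>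

text \<open>
  The coefficient of \<open>h\<^sub>n\<close> in the Hermite expansion of \<open>u\<close>; since the Hermite functions are real-valued,
  it is the value of \<open>u\<close> at \<open>h\<^sub>n\<close>.
\<close>

definition tempered_coeff :: "tempered \<Rightarrow> nat \<Rightarrow> complex"
  where "tempered_coeff u n = tempered_apply u (hermite n)"

lemma tempered_apply_sums:
  "(\<lambda>n. hermite_coeff f n * tempered_coeff u n) sums tempered_apply u f"
proof -
  define S where "S M = (\<Sum>n<M. schwartz_scale (hermite_coeff f n) (hermite n))" for M
  obtain N C where C: "C > 0" "\<And>f. cmod (tempered_apply u f) \<le> C * schwartz_norm N f"
    using tempered_bounded by blast
  have "(\<lambda>M. tempered_apply u (f - S M)) \<longlonglongrightarrow> 0"
  proof (rule Lim_null_comparison)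
    show "\<forall>\<^sub>F M in sequentially. cmod (tempered_apply u (f - S M)) \<le> C * schwartz_norm N (f - S M)"
      using C(2) by simp
    show "(\<lambda>M. C * schwartz_norm N (f - S M)) \<longlonglongrightarrow> 0"
      using tendsto_mult_left[OF hermite_expansion_converges, of C N f] by (simp add: S_def)
  qed
  then have "(\<lambda>M. tempered_apply u f - tempered_apply u (S M)) \<longlonglongrightarrow> 0"
    by (simp add: tempered_apply_diff)
  from tendsto_diff[OF tendsto_const[of "tempered_apply u f"] this]
  have "(\<lambda>M. tempered_apply u (S M)) \<longlonglongrightarrow> tempered_apply u f" by simp
  then show ?thesis
    by (simp add: sums_def S_def tempered_apply_sum tempered_apply_schwartz_scale tempered_coeff_def)
qed

lemma tempered_eqI:
  assumes "\<And>n. tempered_coeff u n = tempered_coeff v n"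
  shows "u = v"
proof -
  have "tempered_apply u f = tempered_apply v f" for f
    using tempered_apply_sums[of f u] tempered_apply_sums[of f v] by (simp add: assms sums_unique2)
  then show ?thesis by (metis ext tempered_apply_inject)
qed

lemma tempered_coeff_bound:
  obtains C m where "C > 0" "\<And>n. cmod (tempered_coeff u n) \<le> C * (real n + 1) ^ m"
proof -
  obtain N C where C: "C > 0" "\<And>f. cmod (tempered_apply u f) \<le> C * schwartz_norm N f"
    using tempered_bounded by blast
  obtain D where D: "D > 0" "\<And>n. schwartz_norm N (hermite n) \<le> D * (real n + 1) ^ (2 * N + 1)"
    using hermite_norm_bound by blast
  have "cmod (tempered_coeff u n) \<le> (C * D) * (real n + 1) ^ (2 * N + 1)" for n
    using order.trans[OF C(2)[of "hermite n"] mult_left_mono[OF D(2)[of n] less_imp_le[OF C(1)]]]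
    by (simp add: tempered_coeff_def mult.assoc)
  then show ?thesis using C(1) D(1) by (intro that[of "C * D" "2 * N + 1"]) auto
qed

lemma hermite_coeff_sum_bound:
  obtains C N where "C > 0"
    "\<And>f. (\<Sum>n. cmod (hermite_coeff f n) * (real n + 1) ^ m) \<le> C * schwartz_norm N f"
proof -
  obtain C N where C: "C > 0" "\<And>f n. cmod (hermite_coeff f n) * (real n + 1) ^ m
      \<le> C * schwartz_norm N f * inverse (real (Suc n) ^ 2)"
    using hermite_coeff_weighted_decay by metis
  define Z where "Z = (\<Sum>n. inverse (real (Suc n) ^ 2))"
  have "(\<Sum>n. cmod (hermite_coeff f n) * (real n + 1) ^ m) \<le> (C * Z) * schwartz_norm N f" for f
  proof -
    have "(\<Sum>n. cmod (hermite_coeff f n) * (real n + 1) ^ m)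
        \<le> (\<Sum>n. C * schwartz_norm N f * inverse (real (Suc n) ^ 2))"
      by (intro suminf_le summable_hermite_coeff summable_mult summable_inverse_Suc_square C)
    also have "\<dots> = (C * Z) * schwartz_norm N f"
      unfolding Z_def by (subst suminf_mult[OF summable_inverse_Suc_square]) simp
    finally show ?thesis .
  qed
  moreover have "Z > 0" unfolding Z_def by (intro suminf_pos summable_inverse_Suc_square) simp
  ultimately show ?thesis using C(1) by (intro that[of "C * Z"]) auto
qed

lemma hermite_series_bound:
  assumes "\<And>n. cmod (a n) \<le> e * (real n + 1) ^ m"
  shows "summable (\<lambda>n. hermite_coeff f n * a n)"
    and "cmod (\<Sum>n. hermite_coeff f n * a n) \<le> e * (\<Sum>n. cmod (hermite_coeff f n) * (real n + 1) ^ m)"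
proof -
  have le: "cmod (hermite_coeff f n * a n) \<le> e * (cmod (hermite_coeff f n) * (real n + 1) ^ m)" for n
    using mult_left_mono[OF assms[of n], of "cmod (hermite_coeff f n)"] by (simp add: norm_mult mult_ac)
  have s: "summable (\<lambda>n. e * (cmod (hermite_coeff f n) * (real n + 1) ^ m))"
    by (intro summable_mult summable_hermite_coeff)
  have sn: "summable (\<lambda>n. cmod (hermite_coeff f n * a n))"
    by (rule summable_comparison_test'[OF s, of 0]) (use le in simp)
  then show "summable (\<lambda>n. hermite_coeff f n * a n)" by (rule summable_norm_cancel)
  have "cmod (\<Sum>n. hermite_coeff f n * a n) \<le> (\<Sum>n. cmod (hermite_coeff f n * a n))"
    by (rule summable_norm[OF sn])
  also have "\<dots> \<le> (\<Sum>n. e * (cmod (hermite_coeff f n) * (real n + 1) ^ m))"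
    by (rule suminf_le[OF le sn s])
  also have "\<dots> = e * (\<Sum>n. cmod (hermite_coeff f n) * (real n + 1) ^ m)"
    by (rule suminf_mult[OF summable_hermite_coeff])
  finally show "cmod (\<Sum>n. hermite_coeff f n * a n) \<le> e * (\<Sum>n. cmod (hermite_coeff f n) * (real n + 1) ^ m)" .
qed

text \<open>Conversely, every sequence of polynomial growth is the coefficient sequence of a distribution.\<close>

lemma tempered_of_coeffs:
  assumes a: "\<And>n. cmod (a n) \<le> K * (real n + 1) ^ m"
  obtains u where "\<And>n. tempered_coeff u n = a n"
proof -
  define L where "L f = (\<Sum>n. hermite_coeff f n * a n)" for f
  obtain C N where C: "C > 0"
    "\<And>f. (\<Sum>n. cmod (hermite_coeff f n) * (real n + 1) ^ m) \<le> C * schwartz_norm N f"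
    using hermite_coeff_sum_bound by blast
  have K: "K \<ge> 0" using order.trans[OF norm_ge_zero a[of 0]] by simp
  note summ = hermite_series_bound(1)[OF a]
  have add: "L (f + g) = L f + L g" for f g
    unfolding L_def by (subst suminf_add[OF summ summ]) (simp add: schwartz_pairing_add_left distrib_right)
  have scale: "L (schwartz_scale c f) = c * L f" for c f
    unfolding L_def by (subst suminf_mult[OF summ, symmetric]) (simp add: schwartz_pairing_scale_left mult.assoc)
  have "continuous_on UNIV L"
  proof (rule continuous_on_schwartz_functionalI)
    show "L (f - g) = L f - L g" for f g
      unfolding L_def by (subst suminf_diff[OF summ summ]) (simp add: schwartz_pairing_diff_left left_diff_distrib)
    show "cmod (L f) \<le> (K * C) * schwartz_norm N f" for f
      unfolding L_def
      using order.trans[OF hermite_series_bound(2)[OF a] mult_left_mono[OF C(2) K]] by (simp add: mult.assoc)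
  qed
  with add scale have app: "tempered_apply (Abs_tempered L) = L"
    by (simp add: Abs_tempered_inverse)
  have "tempered_coeff (Abs_tempered L) n = a n" for n
  proof -
    have "tempered_coeff (Abs_tempered L) n = (\<Sum>k. hermite_coeff (hermite n) k * a k)"
      by (simp add: tempered_coeff_def app L_def)
    also have "\<dots> = (\<Sum>k\<in>{n}. hermite_coeff (hermite n) k * a k)"
      by (rule suminf_finite) (auto simp: hermite_orthonormal)
    finally show ?thesis by (simp add: hermite_orthonormal)
  qed
  then show ?thesis by (rule that)
qed

text \<open>
  The sum of \<open>\<bar>c\<^sub>n(f)\<bar> (n + 1)\<^sup>m\<close> is bounded by a seminorm of \<open>f\<close>, hence bounded on bounded sets; this gives
  uniform convergence on bounded sets.
\<close>

lemma tempered_tendstoI: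
  assumes le: "\<And>j n. cmod (tempered_coeff (v j) n - tempered_coeff u n) \<le> e j * (real n + 1) ^ m"
    and e: "e \<longlonglongrightarrow> 0"
  shows "v \<longlonglongrightarrow> u"
proof (rule topological_tendstoI)
  fix U assume "open U" "u \<in> U"
  then obtain B d where B: "schwartz_bounded B" "d > 0"
    "\<And>w. (\<forall>f\<in>B. cmod (tempered_apply w f - tempered_apply u f) < d) \<Longrightarrow> w \<in> U"
    unfolding open_tempered_def by meson
  obtain C N where C: "C > 0"
    "\<And>f. (\<Sum>n. cmod (hermite_coeff f n) * (real n + 1) ^ m) \<le> C * schwartz_norm N f"
    using hermite_coeff_sum_bound by blast
  obtain D where D: "\<And>f. f \<in> B \<Longrightarrow> schwartz_norm N f \<le> D"
    using schwartz_bounded_norm[OF B(1)] by blast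
  have "(\<lambda>j. e j * (C * D)) \<longlonglongrightarrow> 0"
    using tendsto_mult_left_zero[OF e] by simp
  then have "\<forall>\<^sub>F j in sequentially. e j * (C * D) < d"
    using B(2) by (rule order_tendstoD)
  then show "\<forall>\<^sub>F j in sequentially. v j \<in> U"
  proof eventually_elim
    case (elim j)
    have e0: "e j \<ge> 0" using order.trans[OF norm_ge_zero le[of j 0]] by simp
    have "cmod (tempered_apply (v j) f - tempered_apply u f) < d" if "f \<in> B" for f
    proof -
      have "(\<lambda>n. hermite_coeff f n * (tempered_coeff (v j) n - tempered_coeff u n)) sums
          (tempered_apply (v j) f - tempered_apply u f)"
        unfolding right_diff_distrib by (intro sums_diff tempered_apply_sums)
      from sums_unique[OF this]
      have "cmod (tempered_apply (v j) f - tempered_apply u f)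
          \<le> e j * (\<Sum>n. cmod (hermite_coeff f n) * (real n + 1) ^ m)"
        using hermite_series_bound(2)[of "\<lambda>n. tempered_coeff (v j) n - tempered_coeff u n", OF le] by simp
      also have "\<dots> \<le> e j * (C * D)"
        using C D[OF that] by (intro mult_left_mono e0 order.trans[OF C(2)]) auto
      finally show ?thesis using elim by simp
    qed
    then show ?case by (intro B(3)) blast
  qed
qed

lemma tempered_coeff_annihilation:
  "tempered_coeff (annihilation u) n = sqrt (real (Suc n)) *\<^sub>R tempered_coeff u (Suc n)"
proof -
  have "tempered_coeff (annihilation u) n = (1 / sqrt 2) *\<^sub>R tempered_apply u (raising (hermite n))"
    by (simp add: tempered_coeff_def tempered_apply_annihilation raising_def tempered_apply_diff)
  also have "\<dots> = sqrt (real (Suc n)) *\<^sub>R tempered_coeff u (Suc n)"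
    unfolding raising_hermite tempered_apply_scaleR tempered_coeff_def
    by (simp only: real_sqrt_mult scaleR_scaleR) simp
  finally show ?thesis .
qed

text \<open>On coefficients the annihilation operator is the backward shift with weights \<open>\<surd>n\<close>.\<close>

lemma tempered_coeff_annihilation_power:
  "tempered_coeff ((annihilation ^^ k) u) n = sqrt (fact (n + k) / fact n) *\<^sub>R tempered_coeff u (n + k)"
proof (induction k arbitrary: n)
  case (Suc k)
  have "sqrt (real (Suc n)) * sqrt (fact (Suc n + k) / fact (Suc n)) = sqrt (fact (n + Suc k) / fact n)"
    unfolding real_sqrt_mult[symmetric] by simp
  then show ?case
    by (simp add: tempered_coeff_annihilation Suc)
qed simp

section \<open>Dynamics of the weighted shift\<close>

text \<open>
  To prescribe \<open>z\<close> as the \<open>n\<close>-th coefficient after \<open>k\<close> steps, place \<open>z\<close> at the index \<open>n + k\<close>, divided by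
  the product of the weights in between.
\<close>

lemma tempered_coeff_annihilation_powerI:
  assumes "tempered_coeff x (n + k) = sqrt (fact n / fact (n + k)) *\<^sub>R z"
  shows "tempered_coeff ((annihilation ^^ k) x) n = z"
proof -
  have "sqrt (fact (n + k) / fact n) * sqrt (fact n / fact (n + k)) = 1"
    unfolding real_sqrt_mult[symmetric] by simp
  then show ?thesis
    unfolding tempered_coeff_annihilation_power assms by simp
qed

lemma norm_shift_weight_le:
  fixes z :: complex
  assumes "r \<le> k"
  shows "cmod (sqrt (fact r / fact k) *\<^sub>R z) \<le> cmod z"
proof -
  have "fact r / fact k \<le> (1::real)" using assms by (simp add: fact_mono)
  then have "sqrt (fact r / fact k) \<le> 1" by simp
  then show ?thesis by (simp add: mult_left_le_one_le)
qed

lemma tendsto_const_div_Suc: "(\<lambda>n. C / (real n + 1)) \<longlonglongrightarrow> 0"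
proof -
  have "(\<lambda>n. C * inverse (real (Suc n))) \<longlonglongrightarrow> C * 0"
    by (intro tendsto_mult_left LIMSEQ_inverse_real_of_nat)
  then show ?thesis by (simp add: divide_inverse add.commute)
qed

text \<open>
  Any change beyond the index \<open>n\<close> that respects a polynomial bound is small, of order \<open>1/n\<close>, if it is
  measured with one more power.
\<close>

lemma tail_bound:
  assumes "C \<ge> 0" "n \<le> k"
  shows "C * (real k + 1) ^ m \<le> C / (real n + 1) * (real k + 1) ^ Suc m"
proof -
  have "C * (real k + 1) ^ m * (real n + 1) \<le> C * (real k + 1) ^ m * (real k + 1)"
    using assms by (intro mult_left_mono) auto
  then show ?thesis by (simp add: field_simps)
qed

lemma mixing_annihilation: "mixing annihilation"
  unfolding mixing_def
proof (intro allI impI, elim conjE)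
  fix U W :: "tempered set"
  assume U: "open U" "U \<noteq> {}" and W: "open W" "W \<noteq> {}"
  obtain u w where u: "u \<in> U" and w: "w \<in> W" using U W by blast
  obtain C m where C: "C > 0" "\<And>n. cmod (tempered_coeff u n) \<le> C * (real n + 1) ^ m"
    using tempered_coeff_bound by blast
  obtain D l where D: "D > 0" "\<And>n. cmod (tempered_coeff w n) \<le> D * (real n + 1) ^ l"
    using tempered_coeff_bound by blast
  define p where "p = max m l"
  \<comment> \<open>The first \<open>n\<close> coefficients of \<open>u\<close>, continued such that \<open>n\<close> steps lead exactly to \<open>w\<close>.\<close>
  define y where "y n k = (if k < n then tempered_coeff u k
    else sqrt (fact (k - n) / fact k) *\<^sub>R tempered_coeff w (k - n))" for n k
  have ub: "cmod (tempered_coeff u k) \<le> C * (real k + 1) ^ p" for k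
    using C by (intro order.trans[OF C(2)] mult_left_mono power_increasing) (auto simp: p_def)
  have wb: "cmod (sqrt (fact (k - n) / fact k) *\<^sub>R tempered_coeff w (k - n)) \<le> D * (real k + 1) ^ p" for k n
  proof -
    have "cmod (sqrt (fact (k - n) / fact k) *\<^sub>R tempered_coeff w (k - n)) \<le> cmod (tempered_coeff w (k - n))"
      by (rule norm_shift_weight_le) simp
    also have "\<dots> \<le> D * (real (k - n) + 1) ^ l" by (rule D)
    also have "\<dots> \<le> D * (real k + 1) ^ l"
      using D(1) by (intro mult_left_mono power_mono) auto
    also have "\<dots> \<le> D * (real k + 1) ^ p"
      using D(1) by (intro mult_left_mono power_increasing) (auto simp: p_def)
    finally show ?thesis .
  qed
  have "cmod (y n k) \<le> (C + D) * (real k + 1) ^ p" for n k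
    unfolding y_def distrib_right using ub[of k] wb[of k n] C(1) D(1) by (auto intro: add_increasing add_increasing2)
  then have "\<exists>x. \<forall>k. tempered_coeff x k = y n k" for n
    by (meson tempered_of_coeffs)
  then obtain x where x: "\<And>n k. tempered_coeff (x n) k = y n k" by metis
  have "x \<longlonglongrightarrow> u"
  proof (rule tempered_tendstoI)
    fix n k
    show "cmod (tempered_coeff (x n) k - tempered_coeff u k) \<le> (C + D) / (real n + 1) * (real k + 1) ^ Suc p"
    proof (cases "k < n")
      case True
      then show ?thesis using C D by (simp add: x y_def)
    next
      case False
      then have "cmod (tempered_coeff (x n) k - tempered_coeff u k) \<le> (C + D) * (real k + 1) ^ p"
        unfolding x y_def using order.trans[OF norm_triangle_ineq4 add_mono[OF wb[of k n] ub[of k]]]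
        by (simp add: algebra_simps)
      also have "\<dots> \<le> (C + D) / (real n + 1) * (real k + 1) ^ Suc p"
        using False C D by (intro tail_bound) auto
      finally show ?thesis .
    qed
  qed (rule tendsto_const_div_Suc)
  then have "\<forall>\<^sub>F n in sequentially. x n \<in> U"
    using U(1) u by (rule topological_tendstoD)
  then obtain N where N: "\<And>n. n \<ge> N \<Longrightarrow> x n \<in> U"
    by (auto simp: eventually_sequentially)
  have orbit: "(annihilation ^^ n) (x n) = w" for n
    by (rule tempered_eqI, rule tempered_coeff_annihilation_powerI) (simp add: x y_def)
  have "n \<in> hitting_times annihilation U W" if "n \<ge> N" "n \<ge> 1" for n
    unfolding hitting_times_def using N[OF that(1)] orbit[of n] w that(2) by (auto simp: image_iff)
  then have "{1..} - hitting_times annihilation U W \<subseteq> {..<N}"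
    by (auto simp: not_less[symmetric])
  then show "finite ({1..} - hitting_times annihilation U W)"
    by (rule finite_subset) simp
qed

lemma cofinite_imp_syndetic:
  assumes "finite ({1..} - A)"
  shows "syndetic A"
proof -
  obtain M where M: "\<And>n. n \<in> {1..} - A \<Longrightarrow> n \<le> M"
    using assms by (meson finite_nat_set_iff_bounded_le)
  have "n + Suc M \<in> {n..n + Suc M} \<inter> A" if "n \<ge> 1" for n
    using M[of "n + Suc M"] that by auto
  then have "\<forall>n\<ge>1. {n..n + Suc M} \<inter> A \<noteq> {}" by blast
  then show ?thesis
    unfolding syndetic_def by (intro exI[of _ "Suc M"]) simp
qed

lemma mixing_imp_topologically_ergodic: "mixing T \<Longrightarrow> topologically_ergodic T"
  by (simp add: mixing_def topologically_ergodic_def cofinite_imp_syndetic)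

lemma topologically_ergodic_imp_transitive: "topologically_ergodic T \<Longrightarrow> transitive_map T"
proof -
  have "A \<noteq> {}" if "syndetic A" for A
    using that by (auto simp: syndetic_def)
  then show "topologically_ergodic T \<Longrightarrow> transitive_map T"
    by (simp add: topologically_ergodic_def transitive_map_def)
qed

text \<open>
  The sequence \<open>b\<^bsub>k mod N\<^esub> \<surd>((k mod N)! / k!)\<close> is \<open>N\<close>-periodic for the weighted shift and agrees with
  \<open>b\<close> in the first \<open>N\<close> places.
\<close>

lemma periodic_points_annihilation_dense: "closure (periodic_points annihilation) = UNIV"
proof -
  have "u \<in> closure (periodic_points annihilation)" for u
  proof -
    obtain C m where C: "C > 0" "\<And>n. cmod (tempered_coeff u n) \<le> C * (real n + 1) ^ m"
      using tempered_coeff_bound by blast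
    define y where "y N k = sqrt (fact (k mod N) / fact k) *\<^sub>R tempered_coeff u (k mod N)" for N k
    have yb: "cmod (y N k) \<le> C * (real k + 1) ^ m" for N k
    proof -
      have "cmod (y N k) \<le> cmod (tempered_coeff u (k mod N))"
        unfolding y_def by (intro norm_shift_weight_le) simp
      also have "\<dots> \<le> C * (real (k mod N) + 1) ^ m" by (rule C)
      also have "\<dots> \<le> C * (real k + 1) ^ m"
        using C(1) by (intro mult_left_mono power_mono) auto
      finally show ?thesis .
    qed
    then have "\<exists>x. \<forall>k. tempered_coeff x k = y N k" for N
      by (meson tempered_of_coeffs)
    then obtain x where x: "\<And>N k. tempered_coeff (x N) k = y N k" by metis
    have "x \<longlonglongrightarrow> u"
    proof (rule tempered_tendstoI)
      fix N k
      show "cmod (tempered_coeff (x N) k - tempered_coeff u k) \<le> (C + C) / (real N + 1) * (real k + 1) ^ Suc m"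
      proof (cases "k < N")
        case True
        then show ?thesis using C by (simp add: x y_def)
      next
        case False
        have "cmod (tempered_coeff (x N) k - tempered_coeff u k) \<le> (C + C) * (real k + 1) ^ m"
          unfolding x using order.trans[OF norm_triangle_ineq4 add_mono[OF yb[of N k] C(2)[of k]]]
          by (simp add: algebra_simps)
        also have "\<dots> \<le> (C + C) / (real N + 1) * (real k + 1) ^ Suc m"
          using False C by (intro tail_bound) auto
        finally show ?thesis .
      qed
    qed (rule tendsto_const_div_Suc)
    moreover have "(annihilation ^^ N) (x N) = x N" for N
    proof (rule tempered_eqI, rule tempered_coeff_annihilation_powerI)
      fix k
      have "sqrt (fact k / fact (k + N)) * sqrt (fact (k mod N) / fact k) = sqrt (fact (k mod N) / fact (k + N))"
        unfolding real_sqrt_mult[symmetric] by simp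
      then show "tempered_coeff (x N) (k + N) = sqrt (fact k / fact (k + N)) *\<^sub>R tempered_coeff (x N) k"
        by (simp add: x y_def)
    qed
    then have "x (Suc N) \<in> periodic_points annihilation" for N
      unfolding periodic_points_def by (auto intro!: exI[of _ "Suc N"] simp del: funpow.simps)
    ultimately show ?thesis
      by (intro Lim_in_closed_set[OF closed_closure always_eventually sequentially_bot LIMSEQ_Suc])
        (auto intro: closure_subset[THEN subsetD])
  qed
  then show ?thesis by blast
qed

text \<open>
  A sequence of vectors, the \<open>i\<close>-th bounded by \<open>i\<close>, that contains approximations of every given
  sequence, truncated to any length, at arbitrarily late positions.
\<close>

lemma exists_dense_slow_sequence:
  obtains Y :: "nat \<Rightarrow> nat \<Rightarrow> complex"
  where "\<And>i k. cmod (Y i k) \<le> real i"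
    and "\<And>b t. \<exists>i\<ge>t. (\<forall>k<t. cmod (Y i k - b k) \<le> 1 / (real t + 1)) \<and> (\<forall>k\<ge>t. Y i k = 0)"
proof -
  define val :: "(rat \<times> rat) list \<Rightarrow> nat \<Rightarrow> complex" where
    "val l k = (if k < length l then Complex (of_rat (fst (l ! k))) (of_rat (snd (l ! k))) else 0)" for l k
  \<comment> \<open>Decoding pairs of a list and a number makes every list occur infinitely often, so also at an
    index that exceeds its entries; where the bound fails, \<open>Y i\<close> is set to zero.\<close>
  define L :: "nat \<Rightarrow> (rat \<times> rat) list" where "L i = fst (from_nat i :: (rat \<times> rat) list \<times> nat)" for i
  define Y where "Y i k = (if \<forall>k. cmod (val (L i) k) \<le> real i then val (L i) k else 0)" for i k
  have "cmod (Y i k) \<le> real i" for i k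
    by (auto simp: Y_def)
  moreover have "\<exists>i\<ge>t. (\<forall>k<t. cmod (Y i k - b k) \<le> 1 / (real t + 1)) \<and> (\<forall>k\<ge>t. Y i k = 0)" for b t
  proof -
    have "\<exists>q. cmod (Complex (of_rat (fst q)) (of_rat (snd q)) - b k) \<le> 1 / (real t + 1)" for k
    proof -
      have approx: "\<exists>q. \<bar>of_rat q - r\<bar> \<le> 1 / (2 * (real t + 1))" for r
      proof -
        have "r < r + 1 / (2 * (real t + 1))" by simp
        then obtain q where "r < of_rat q" "of_rat q < r + 1 / (2 * (real t + 1))"
          using of_rat_dense by blast
        then have "\<bar>of_rat q - r\<bar> \<le> 1 / (2 * (real t + 1))" by linarith
        then show ?thesis by blast
      qed
      obtain q1 q2 where q: "\<bar>of_rat q1 - Re (b k)\<bar> \<le> 1 / (2 * (real t + 1))"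
        "\<bar>of_rat q2 - Im (b k)\<bar> \<le> 1 / (2 * (real t + 1))"
        using approx by blast
      have "cmod (Complex (of_rat q1) (of_rat q2) - b k) \<le> 1 / (2 * (real t + 1)) + 1 / (2 * (real t + 1))"
        using q by (intro order.trans[OF cmod_le] add_mono) auto
      also have "\<dots> = 1 / (real t + 1)" by (simp add: field_simps)
      finally show ?thesis by (intro exI[of _ "(q1, q2)"]) simp
    qed
    then obtain q where q: "\<And>k. cmod (Complex (of_rat (fst (q k))) (of_rat (snd (q k))) - b k) \<le> 1 / (real t + 1)"
      by metis
    define l where "l = map q [0..<t]"
    define K where "K = (\<Sum>k<t. cmod (val l k))"
    have K: "cmod (val l k) \<le> K" for k
    proof (cases "k < t")
      case True
      then show ?thesis unfolding K_def by (intro member_le_sum) auto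
    next
      case False
      then show ?thesis by (auto simp: val_def l_def K_def intro: sum_nonneg)
    qed
    have "infinite (range (\<lambda>s::nat. to_nat (l, s)))"
      by (intro range_inj_infinite injI) simp
    then have "\<exists>i\<ge>max t (nat \<lceil>K\<rceil>). i \<in> range (\<lambda>s::nat. to_nat (l, s))"
      by (simp only: infinite_nat_iff_unbounded_le)
    then obtain s :: nat where s: "to_nat (l, s) \<ge> max t (nat \<lceil>K\<rceil>)"
      by auto
    define i where "i = to_nat (l, s)"
    have "real i \<ge> K" using s by (simp add: i_def)
    moreover have Li: "L i = l" by (simp add: L_def i_def)
    ultimately have Yi: "Y i k = val l k" for k
      using K by (auto simp: Y_def intro: order.trans)
    have "t \<le> i" using s by (simp add: i_def)
    then show ?thesis
      using q by (intro exI[of _ i]) (auto simp: Yi val_def l_def)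
  qed
  ultimately show ?thesis by (rule that)
qed

text \<open>
  The hypercyclic vector consists of blocks: its part in the places \<open>i\<^sup>2 \<le> k < (i + 1)\<^sup>2\<close> is that of the
  image of \<open>Y i\<close> under the \<open>i\<^sup>2\<close>-th power of the right inverse of the weighted shift.  The \<open>j\<^sup>2\<close>-th power
  of the shift moves the \<open>j\<close>-th block to the front.  The later blocks then start beyond the index \<open>j\<close>, and
  as \<open>Y i\<close> is bounded by \<open>i\<close>, the \<open>k\<close>-th coefficient there is at most \<open>k\<close>.
\<close>

lemma sequentially_hypercyclic_annihilation: "sequentially_hypercyclic annihilation"
proof -
  obtain Y :: "nat \<Rightarrow> nat \<Rightarrow> complex" where Yb: "\<And>i k. cmod (Y i k) \<le> real i"
    and Yd: "\<And>b t. \<exists>i\<ge>t. (\<forall>k<t. cmod (Y i k - b k) \<le> 1 / (real t + 1)) \<and> (\<forall>k\<ge>t. Y i k = 0)"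
    using exists_dense_slow_sequence by blast
  define z where "z k = (let i = floor_sqrt k in sqrt (fact (k - i\<^sup>2) / fact k) *\<^sub>R Y i (k - i\<^sup>2))" for k
  have zb: "cmod (z k) \<le> 1 * (real k + 1) ^ 1" for k
  proof -
    have "cmod (z k) \<le> cmod (Y (floor_sqrt k) (k - (floor_sqrt k)\<^sup>2))"
      unfolding z_def Let_def by (rule norm_shift_weight_le) simp
    also have "\<dots> \<le> real (floor_sqrt k)" by (rule Yb)
    also have "\<dots> \<le> real k" using floor_sqrt_le[of k] by simp
    finally show ?thesis by simp
  qed
  obtain x where x: "\<And>k. tempered_coeff x k = z k"
    using tempered_of_coeffs[OF zb] by blast
  define v where "v j = (annihilation ^^ (j\<^sup>2)) x" for j
  \<comment> \<open>The index \<open>k + j\<^sup>2\<close> lies in the block \<open>i \<ge> j\<close>, at its position \<open>r\<close>.\<close>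
  have v: "tempered_coeff (v j) k = Y j k \<or> (j < k \<and> cmod (tempered_coeff (v j) k) \<le> real k)" for j k
  proof -
    define i where "i = floor_sqrt (k + j\<^sup>2)"
    have i: "i\<^sup>2 \<le> k + j\<^sup>2" unfolding i_def by (rule floor_sqrt_power2_le)
    have "j \<le> i" unfolding i_def by (rule le_floor_sqrtI) simp
    then have ij: "j\<^sup>2 \<le> i\<^sup>2" by simp
    define r where "r = k + j\<^sup>2 - i\<^sup>2"
    have r: "r \<le> k" unfolding r_def using ij by linarith
    have "tempered_coeff (v j) k = sqrt (fact r / fact k) *\<^sub>R Y i r"
      unfolding v_def
    proof (rule tempered_coeff_annihilation_powerI)
      have "sqrt (fact k / fact (k + j\<^sup>2)) * sqrt (fact r / fact k) = sqrt (fact r / fact (k + j\<^sup>2))"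
        unfolding real_sqrt_mult[symmetric] by simp
      then show "tempered_coeff x (k + j\<^sup>2) = sqrt (fact k / fact (k + j\<^sup>2)) *\<^sub>R (sqrt (fact r / fact k) *\<^sub>R Y i r)"
        by (simp add: x z_def Let_def flip: i_def r_def)
    qed
    show ?thesis
    proof (cases "i = j")
      case True
      then show ?thesis using \<open>tempered_coeff (v j) k = _\<close> by (simp add: r_def)
    next
      case False
      with \<open>j \<le> i\<close> have "j + 1 \<le> i" by simp
      then have "j * j \<le> (i - 1) * (i - 1)" by (intro mult_le_mono) auto
      with \<open>j + 1 \<le> i\<close> have "j\<^sup>2 + i \<le> i\<^sup>2"
        by (cases i) (auto simp: power2_eq_square)
      then have "i \<le> k" using i by linarith
      have "cmod (tempered_coeff (v j) k) \<le> cmod (Y i r)"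
        unfolding \<open>tempered_coeff (v j) k = _\<close> by (rule norm_shift_weight_le[OF r])
      also have "\<dots> \<le> real i" by (rule Yb)
      also have "\<dots> \<le> real k" using \<open>i \<le> k\<close> by simp
      finally show ?thesis using \<open>j + 1 \<le> i\<close> \<open>i \<le> k\<close> by simp
    qed
  qed
  have "\<exists>s. (\<forall>t::nat. s t \<in> range (\<lambda>n. (annihilation ^^ n) x)) \<and> s \<longlonglongrightarrow> y" for y
  proof -
    obtain C m where C: "C > 0" "\<And>n. cmod (tempered_coeff y n) \<le> C * (real n + 1) ^ m"
      using tempered_coeff_bound by blast
    obtain j where j: "\<And>t. j t \<ge> t"
      "\<And>t k. k < t \<Longrightarrow> cmod (Y (j t) k - tempered_coeff y k) \<le> 1 / (real t + 1)"
      "\<And>t k. k \<ge> t \<Longrightarrow> Y (j t) k = 0"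
      using Yd[of _ "tempered_coeff y"] by metis
    have "(\<lambda>t. v (j t)) \<longlonglongrightarrow> y"
    proof (rule tempered_tendstoI)
      fix t k
      have one: "1 \<le> (real k + 1) ^ Suc (Suc m)" by (rule one_le_power) simp
      show "cmod (tempered_coeff (v (j t)) k - tempered_coeff y k)
          \<le> (1 + C) / (real t + 1) * (real k + 1) ^ Suc (Suc m)"
      proof (cases "k < t")
        case True
        then have "tempered_coeff (v (j t)) k = Y (j t) k"
          using v[of "j t" k] j(1)[of t] by auto
        then have "cmod (tempered_coeff (v (j t)) k - tempered_coeff y k) \<le> 1 / (real t + 1) * 1"
          using j(2)[OF True] by simp
        also have "\<dots> \<le> (1 + C) / (real t + 1) * (real k + 1) ^ Suc (Suc m)"
          using C(1) by (intro mult_mono divide_right_mono one) auto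
        finally show ?thesis .
      next
        case False
        have "cmod (tempered_coeff (v (j t)) k) \<le> real k"
          using v[of "j t" k] j(3)[of t k] False by auto
        also have "\<dots> \<le> (real k + 1) ^ 1" by simp
        also have "\<dots> \<le> (real k + 1) ^ Suc m" by (rule power_increasing) auto
        finally have "cmod (tempered_coeff (v (j t)) k) \<le> (real k + 1) ^ Suc m" .
        moreover have "cmod (tempered_coeff y k) \<le> C * (real k + 1) ^ Suc m"
          using C(1) by (intro order.trans[OF C(2)] mult_left_mono power_increasing) auto
        ultimately have "cmod (tempered_coeff (v (j t)) k - tempered_coeff y k) \<le> (1 + C) * (real k + 1) ^ Suc m"
          unfolding distrib_right by (intro order.trans[OF norm_triangle_ineq4] add_mono) simp_all
        also have "\<dots> \<le> (1 + C) / (real t + 1) * (real k + 1) ^ Suc (Suc m)"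
          using False C(1) by (intro tail_bound) auto
        finally show ?thesis .
      qed
    qed (rule tendsto_const_div_Suc)
    then show ?thesis by (intro exI[of _ "\<lambda>t. v (j t)"]) (auto simp: v_def)
  qed
  then show ?thesis
    unfolding sequentially_hypercyclic_def sequentially_dense_def by blast
qed

theorem corollary4p2:
  shows "mixing annihilation \<and> sequentially_hypercyclic annihilation \<and>
    topologically_ergodic annihilation \<and> chaotic annihilation"
  using mixing_annihilation sequentially_hypercyclic_annihilation
    mixing_imp_topologically_ergodic[OF mixing_annihilation]
    topologically_ergodic_imp_transitive[OF mixing_imp_topologically_ergodic[OF mixing_annihilation]]
    periodic_points_annihilation_dense
  by (simp add: chaotic_def)

end
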